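(* For every integer $n\ge 1$ there exists a constant $C=C(n)$ such that the following holds. Let $r>0$ and let $u: B_{\sqrt{2n+1}\, r}\times[0,r^2]\to\mathbb{R}$ be a function whose graph flows by mean curvature. Then $$\log |du|\left(0,\tfrac{r^2}{4n}\right)\le C\,\bigl(1+r^{-1}\,\|u(\cdot,0)\|_\infty\bigr)^2 .$$
   Context: $B_s$ denotes the ball in $\mathbb{R}^n$ of radius $s$ centered at the origin. For a function $u=u(x,t)$, $du$ denotes the gradient in the $\mathbb{R}^n$-variable $x$, and $\operatorname{div}$ is the divergence in $\mathbb{R}^n$. The graph of $u$ flows by mean curvature if $u$ is smooth (the hypersurfaces $M_t=\{(x,y): y=u(x,t)\}\subset\mathbb{R}^{n+1}$ form a smooth one-parameter family) and $$u_t=(1+|du|^2)^{1/2}\,\operatorname{div}\left(\frac{du}{(1+|du|^2)^{1/2}}\right).$$ $\|u(\cdot,0)\|_\infty$ is the sup norm of $u(\cdot,0)$ on its domain $B_{\sqrt{2n+1}\,r}$. If $|du|=0$ at the point in question, the logarithm is read as $-\infty$. *)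

theory Defs
  imports "HOL-Analysis.Analysis"
begin

text \<open>
  Derivatives are taken within \<open>S\<close>, hence one-sided at boundary points of \<open>S\<close>. The intended
  \<open>S\<close> are convex with nonempty interior, where such derivatives are unique.
\<close>

primrec Ck_on :: "nat \<Rightarrow> 'a::euclidean_space set \<Rightarrow> ('a \<Rightarrow> real) \<Rightarrow> bool" where
  "Ck_on 0 S f \<longleftrightarrow> continuous_on S f"
| "Ck_on (Suc k) S f \<longleftrightarrow>
     (\<exists>f'. (\<forall>x\<in>S. (f has_derivative f' x) (at x within S)) \<and> (\<forall>v. Ck_on k S (\<lambda>x. f' x v)))"

definition smooth_on :: "'a::euclidean_space set \<Rightarrow> ('a \<Rightarrow> real) \<Rightarrow> bool" where
  "smooth_on S f \<longleftrightarrow> (\<forall>k. Ck_on k S f)"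

definition gradient :: "('a::euclidean_space \<Rightarrow> real) \<Rightarrow> 'a \<Rightarrow> 'a" where
  "gradient f x = (\<Sum>b\<in>Basis. frechet_derivative f (at x) b *\<^sub>R b)"

definition divergence :: "('a::euclidean_space \<Rightarrow> 'a) \<Rightarrow> 'a \<Rightarrow> real" where
  "divergence F x = (\<Sum>b\<in>Basis. frechet_derivative F (at x) b \<bullet> b)"

text \<open>
  The graph of \<open>u\<close> over the open ball of radius \<open>R\<close> flows by mean curvature during \<open>[0, T]\<close>;
  the time derivative is one-sided at the endpoints. Values of \<open>u\<close> elsewhere are irrelevant.
\<close>

definition graph_flows_by_mean_curvature ::
    "real \<Rightarrow> real \<Rightarrow> ('a::euclidean_space \<Rightarrow> real \<Rightarrow> real) \<Rightarrow> bool" where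
  "graph_flows_by_mean_curvature R T u \<longleftrightarrow>
     smooth_on (ball 0 R \<times> {0..T}) (\<lambda>(x, t). u x t) \<and>
     (\<forall>x\<in>ball 0 R. \<forall>t\<in>{0..T}.
        ((\<lambda>s. u x s) has_real_derivative
           sqrt (1 + (norm (gradient (\<lambda>z. u z t) x))\<^sup>2) *
           divergence (\<lambda>y. gradient (\<lambda>z. u z t) y /\<^sub>R
                             sqrt (1 + (norm (gradient (\<lambda>z. u z t) y))\<^sup>2)) x)
        (at t within {0..T}))"

text \<open>The sup norm takes the value \<open>\<infinity>\<close> when \<open>f\<close> is unbounded on \<open>S\<close>.\<close>

definition sup_norm_on :: "'a set \<Rightarrow> ('a \<Rightarrow> real) \<Rightarrow> ereal" where
  "sup_norm_on S f = (SUP x\<in>S. ereal \<bar>f x\<bar>)"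

text \<open>Unlike \<^const>\<open>ln\<close>, which is \<open>0\<close> at \<open>0\<close>, this has the value \<open>-\<infinity>\<close> there.\<close>

definition ext_log :: "real \<Rightarrow> ereal" where
  "ext_log s = (if s = 0 then -\<infinity> else ereal (ln s))"

end

theory Submission
  imports Defs
begin

text \<open>
  Write \<open>p = du\<close>, \<open>v = sqrt (1 + |p|\<^sup>2)\<close> and let \<open>L\<close> be the second-order operator in \<open>x\<close> with coefficient
  matrix \<open>I - p p\<^sup>T / v\<^sup>2\<close>, so that the flow reads \<open>u\<^sub>t = L u\<close>.
  Since \<open>(\<partial>\<^sub>t - L) (|x|\<^sup>2 + (u - A)\<^sup>2 + 2 n t) = 0\<close>, the graph avoids shrinking spheres; this bounds
  \<open>|u|\<close> on \<open>B\<^sub>r\<close> by \<open>sup |u(\<cdot>, 0)| + 2 r\<close> up to time \<open>r\<^sup>2 / (4 n)\<close>. For the gradient one follows Korevaar and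
  maximizes \<open>(exp (\<mu> \<psi>) - 1) v\<close>, where \<open>\<psi>\<close> is a cutoff in \<open>x\<close> and \<open>t\<close> plus \<open>u / N\<close>, with \<open>N\<close> comparable
  to the height bound. Because \<open>(\<partial>\<^sub>t - L) v \<le> - 2 |\<nabla>v|\<^sup>2 / v\<close>, with \<open>|\<nabla>g|\<^sup>2\<close> the square for the matrix of \<open>L\<close>,
  at the maximum \<open>\<mu> |\<nabla>\<psi>|\<^sup>2 \<le> (\<partial>\<^sub>t - L) \<psi>\<close>. Where \<open>v\<close> is large the term \<open>u / N\<close> makes
  \<open>|\<nabla>\<psi>|\<^sup>2\<close> at least a multiple of \<open>1 / N\<^sup>2\<close>, so this fails for \<open>\<mu>\<close> a large multiple of \<open>(N / r)\<^sup>2\<close>.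
\<close>

section \<open>Directional derivatives of smooth functions\<close>

lemma Ck_on_subset: "Ck_on k S f \<Longrightarrow> U \<subseteq> S \<Longrightarrow> Ck_on k U f"
proof (induction k arbitrary: f)
  case 0
  then show ?case by (auto intro: continuous_on_subset)
next
  case (Suc k)
  then obtain f' where "\<forall>x\<in>S. (f has_derivative f' x) (at x within S)"
    "\<forall>v. Ck_on k S (\<lambda>x. f' x v)" by auto
  with Suc show ?case
    by (auto intro!: exI[of _ f'] intro: has_derivative_subset)
qed

lemma Ck_on_cong: "Ck_on k S f \<Longrightarrow> (\<And>x. x \<in> S \<Longrightarrow> f x = g x) \<Longrightarrow> Ck_on k S g"
proof (induction k arbitrary: f g)
  case 0
  then show ?case by (simp cong: continuous_on_cong)
next
  case (Suc k)
  then obtain f' where "\<forall>x\<in>S. (f has_derivative f' x) (at x within S)"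
    "\<forall>v. Ck_on k S (\<lambda>x. f' x v)" by auto
  with Suc.prems(2) show ?case
    unfolding Ck_on.simps by (metis has_derivative_transform)
qed

text \<open>Taking the direction first makes \<open>dd v\<close> an operator on functions, so that
  mixed derivatives are iterates such as \<open>dd w (dd v f)\<close>.\<close>

definition dd :: "'a::real_normed_vector \<Rightarrow> ('a \<Rightarrow> real) \<Rightarrow> 'a \<Rightarrow> real" where
  "dd v f z = frechet_derivative f (at z) v"

lemma smooth_on_subset: "smooth_on S f \<Longrightarrow> U \<subseteq> S \<Longrightarrow> smooth_on U f"
  unfolding smooth_on_def using Ck_on_subset by blast

lemma smooth_on_imp_continuous_on: "smooth_on S f \<Longrightarrow> continuous_on S f"
  unfolding smooth_on_def by (metis Ck_on.simps(1))

text \<open>At a point of an open set the derivative within the set is the full derivative and hence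
  unique. This identifies the existential witness in \<open>Ck_on\<close> with
  \<open>frechet_derivative\<close>.\<close>

lemma Ck_on_Suc_open:
  assumes "open U" "Ck_on (Suc k) U f"
  shows "\<forall>z\<in>U. f differentiable (at z)" "Ck_on k U (dd v f)"
proof -
  from assms obtain f' where f': "\<forall>x\<in>U. (f has_derivative f' x) (at x within U)"
    "\<forall>v. Ck_on k U (\<lambda>x. f' x v)" by auto
  then have at: "(f has_derivative f' x) (at x)" if "x \<in> U" for x
    using assms(1) at_within_open[OF that] that by force
  then show "\<forall>z\<in>U. f differentiable (at z)" unfolding differentiable_def by blast
  have "f' x v = dd v f x" if "x \<in> U" for x
    using frechet_derivative_at[OF at[OF that]] by (simp add: dd_def)
  then show "Ck_on k U (dd v f)" using f'(2) Ck_on_cong by blast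
qed

lemma smooth_on_differentiable:
  assumes "open U" "smooth_on U f" "z \<in> U"
  shows "f differentiable (at z)"
  using assms Ck_on_Suc_open(1)[of U 0 f] unfolding smooth_on_def by blast

lemma smooth_on_dd:
  assumes "open U" "smooth_on U f"
  shows "smooth_on U (dd v f)"
  using assms Ck_on_Suc_open(2) unfolding smooth_on_def by blast

lemma
  assumes "open U" "smooth_on U f" "z \<in> U"
  shows dd_scaleR: "dd (c *\<^sub>R v) f z = c * dd v f z"
    and dd_sum: "dd (\<Sum>i\<in>I. g i) f z = (\<Sum>i\<in>I. dd (g i) f z)"
proof -
  have l: "linear (frechet_derivative f (at z))"
    using linear_frechet_derivative smooth_on_differentiable[OF assms] .
  show "dd (c *\<^sub>R v) f z = c * dd v f z" "dd (\<Sum>i\<in>I. g i) f z = (\<Sum>i\<in>I. dd (g i) f z)"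
    using l unfolding dd_def by (auto simp: linear_scale linear_sum)
qed

lemma dd_cong_open:
  assumes "open U" "smooth_on U f" "z \<in> U" "\<And>x. x \<in> U \<Longrightarrow> f x = g x"
  shows "dd v f z = dd v g z"
  using frechet_derivative_transform_within_open[OF smooth_on_differentiable[OF assms(1-3)] assms(1,3,4)]
  by (simp add: dd_def)

lemma DERIV_line:
  assumes "open U" "smooth_on U f" "z + s *\<^sub>R v \<in> U"
  shows "((\<lambda>s. f (z + s *\<^sub>R v)) has_real_derivative dd v f (z + s *\<^sub>R v)) (at s)"
proof -
  let ?z = "z + s *\<^sub>R v"
  have "(f has_derivative frechet_derivative f (at ?z)) (at ?z)"
    using smooth_on_differentiable[OF assms] frechet_derivative_works by blast
  moreover have "((\<lambda>s. z + s *\<^sub>R v) has_derivative (\<lambda>h. h *\<^sub>R v)) (at s)"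
    by (auto intro!: derivative_eq_intros)
  ultimately have "((\<lambda>s. f (z + s *\<^sub>R v)) has_derivative (\<lambda>h. frechet_derivative f (at ?z) (h *\<^sub>R v))) (at s)"
    using diff_chain_at[of "\<lambda>s. z + s *\<^sub>R v" "\<lambda>h. h *\<^sub>R v" s f] by (simp add: o_def)
  moreover have "frechet_derivative f (at ?z) (h *\<^sub>R v) = dd v f ?z * h" for h
    using dd_scaleR[OF assms, of h v] by (simp add: dd_def)
  ultimately show ?thesis by (simp add: has_field_derivative_def)
qed

text \<open>The mean value theorem is used twice: along \<open>v\<close> for the
  \<open>w\<close>-difference of \<open>f\<close>, then along \<open>w\<close> for
  \<open>dd v f\<close>.\<close>

lemma second_difference_MVT:
  assumes U: "open U" "smooth_on U f" and B: "ball z e \<subseteq> U"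
    and h: "0 < h" "h * (norm v + norm w) < e"
  shows "\<exists>p. dist p z < e \<and>
     f (z + h *\<^sub>R v + h *\<^sub>R w) - f (z + h *\<^sub>R v) - f (z + h *\<^sub>R w) + f z = h\<^sup>2 * dd w (dd v f) p"
proof -
  have near: "dist (z + a *\<^sub>R v + b *\<^sub>R w) z \<le> h * (norm v + norm w)" if "0 \<le> a" "a \<le> h" "0 \<le> b" "b \<le> h" for a b
  proof -
    have "dist (z + a *\<^sub>R v + b *\<^sub>R w) z = norm (a *\<^sub>R v + b *\<^sub>R w)" by (simp add: dist_norm add.assoc)
    also have "\<dots> \<le> norm (a *\<^sub>R v) + norm (b *\<^sub>R w)" by (rule norm_triangle_ineq)
    also have "\<dots> = a * norm v + b * norm w" using that by simp
    also have "\<dots> \<le> h * norm v + h * norm w"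
      using that by (intro add_mono mult_right_mono) auto
    finally show ?thesis by (simp add: algebra_simps)
  qed
  have inU: "z + a *\<^sub>R v + b *\<^sub>R w \<in> U" if "0 \<le> a" "a \<le> h" "0 \<le> b" "b \<le> h" for a b
    using near[OF that] h B by (auto simp: dist_commute subset_iff)
  have d: "((\<lambda>s. f (z + s *\<^sub>R v + h *\<^sub>R w) - f (z + s *\<^sub>R v)) has_real_derivative
     dd v f (z + s *\<^sub>R v + h *\<^sub>R w) - dd v f (z + s *\<^sub>R v)) (at s)" if "0 \<le> s" "s \<le> h" for s
    using DERIV_diff[OF DERIV_line[OF U, of "z + h *\<^sub>R w" s v] DERIV_line[OF U, of "z" s v]]
      inU[of s h] inU[of s 0] that h by (simp add: add_ac)
  obtain a where a: "0 < a" "a < h" "(f (z + h *\<^sub>R v + h *\<^sub>R w) - f (z + h *\<^sub>R v)) - (f (z + h *\<^sub>R w) - f z)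
      = h * (dd v f (z + a *\<^sub>R v + h *\<^sub>R w) - dd v f (z + a *\<^sub>R v))"
    using MVT2[OF h(1) d] by auto
  have d2: "((\<lambda>s. dd v f (z + a *\<^sub>R v + s *\<^sub>R w)) has_real_derivative
     dd w (dd v f) (z + a *\<^sub>R v + s *\<^sub>R w)) (at s)" if "0 \<le> s" "s \<le> h" for s
    using DERIV_line[OF U(1) smooth_on_dd[OF U], of "z + a *\<^sub>R v" s w] inU[of a s] that a by simp
  obtain b where b: "0 < b" "b < h" "dd v f (z + a *\<^sub>R v + h *\<^sub>R w) - dd v f (z + a *\<^sub>R v)
      = h * dd w (dd v f) (z + a *\<^sub>R v + b *\<^sub>R w)"
    using MVT2[OF h(1) d2] by auto
  show ?thesis
    using a b near[of a b] h
    by (intro exI[of _ "z + a *\<^sub>R v + b *\<^sub>R w"]) (auto simp: power2_eq_square)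
qed

lemma dd_commute:
  assumes U: "open U" "smooth_on U f" "z \<in> U"
  shows "dd w (dd v f) z = dd v (dd w f) z"
proof (rule ccontr)
  let ?A = "dd w (dd v f)" and ?B = "dd v (dd w f)"
  assume ne: "?A z \<noteq> ?B z"
  define e where "e = \<bar>?A z - ?B z\<bar> / 2"
  have e: "e > 0" using ne by (simp add: e_def)
  have "isCont g z" if "smooth_on U g" for g
    using smooth_on_imp_continuous_on[OF that] U continuous_on_eq_continuous_at by blast
  then have c: "isCont ?A z" "isCont ?B z" by (simp_all add: smooth_on_dd U)
  obtain d1 where d1: "d1 > 0" "\<And>p. dist p z < d1 \<Longrightarrow> dist (?A p) (?A z) < e"
    using c(1) e unfolding continuous_at_eps_delta by blast
  obtain d2 where d2: "d2 > 0" "\<And>p. dist p z < d2 \<Longrightarrow> dist (?B p) (?B z) < e"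
    using c(2) e unfolding continuous_at_eps_delta by blast
  obtain d3 where d3: "d3 > 0" "ball z d3 \<subseteq> U" using U open_contains_ball by blast
  define d where "d = min d1 (min d2 d3)"
  have d: "d > 0" "ball z d \<subseteq> U" using d1 d2 d3 by (auto simp: d_def)
  \<comment> \<open>The parallelogram spanned by \<open>h v\<close> and \<open>h w\<close> at
    \<open>z\<close> then stays in \<open>ball z d\<close>; the summand 1 keeps the denominator
    positive when \<open>v = w = 0\<close>.\<close>
  define h where "h = d / (2 * (norm v + norm w + 1))"
  have s: "norm v + norm w + 1 > 0" by (smt (verit) norm_ge_zero)
  have h: "h > 0" using d s by (auto simp: h_def)
  have "h * (norm v + norm w) < h * (2 * (norm v + norm w + 1))"
    using h s by (intro mult_strict_left_mono) auto
  also have "\<dots> = d" using s by (simp add: h_def)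
  finally have hd: "h * (norm v + norm w) < d" .
  obtain p where p: "dist p z < d" "f (z + h *\<^sub>R v + h *\<^sub>R w) - f (z + h *\<^sub>R v) - f (z + h *\<^sub>R w) + f z = h\<^sup>2 * ?A p"
    using second_difference_MVT[OF U(1,2) d(2) h hd] by blast
  obtain q where q: "dist q z < d" "f (z + h *\<^sub>R w + h *\<^sub>R v) - f (z + h *\<^sub>R w) - f (z + h *\<^sub>R v) + f z = h\<^sup>2 * ?B q"
    using second_difference_MVT[OF U(1,2) d(2) h, of w v] hd by (auto simp: add.commute)
  have sw: "z + h *\<^sub>R w + h *\<^sub>R v = z + h *\<^sub>R v + h *\<^sub>R w" by simp
  \<comment> \<open>The second difference is symmetric in \<open>v\<close> and \<open>w\<close>, so
    the mixed derivatives share a value at nearby points \<open>p\<close> and \<open>q\<close>,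
    while \<open>e\<close> is half of their supposed gap at \<open>z\<close>.\<close>
  have "h\<^sup>2 * ?A p = h\<^sup>2 * ?B q" using p(2) q(2) unfolding sw by linarith
  then have "?A p = ?B q" using h by simp
  moreover have "dist (?A p) (?A z) < e" "dist (?B q) (?B z) < e"
    using p q d1 d2 by (auto simp: d_def)
  ultimately show False unfolding e_def dist_real_def by (smt (verit) field_sum_of_halves)
qed

section \<open>Derivative tests at maxima in one variable\<close>

lemma local_max_second_derivative:
  fixes h :: "real \<Rightarrow> real"
  assumes d: "d > 0" and h: "\<And>s. \<bar>s\<bar> < d \<Longrightarrow> (h has_real_derivative h1 s) (at s)"
    and h1: "(h1 has_real_derivative D) (at 0)"
    and max: "\<And>s. \<bar>s\<bar> < d \<Longrightarrow> h s \<le> h 0"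
  shows "h1 0 = 0" "D \<le> 0"
proof -
  show z: "h1 0 = 0"
    using DERIV_local_max[OF h[of 0] d] max d by auto
  show "D \<le> 0"
  proof (rule ccontr)
    \<comment> \<open>A positive derivative of \<open>h1\<close> at its zero would make
      \<open>h1\<close> positive just to the right, and \<open>h\<close> would increase
      there.\<close>
    assume "\<not> D \<le> 0"
    then obtain e where e: "e > 0" "\<And>s. 0 < s \<Longrightarrow> s < e \<Longrightarrow> h1 0 < h1 s"
      using DERIV_pos_inc_right[OF h1] by auto
    define s where "s = min d e / 2"
    have s: "0 < s" "s < d" "s < e" using d e by (auto simp: s_def)
    obtain x where "0 < x" "x < s" "h s - h 0 = (s - 0) * h1 x"
      using MVT2[of 0 s h h1] h s by auto
    moreover have "h1 x > 0" using e(2)[of x] z s calculation by simp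
    ultimately have "h s > h 0" using s by (smt (verit) mult_pos_pos)
    then show False using max[of s] s by simp
  qed
qed

text \<open>Comparison with earlier points is all that a maximum over a spacetime cylinder gives at
  its final time.\<close>

lemma left_max_derivative:
  fixes h :: "real \<Rightarrow> real"
  assumes d: "d > 0" and h: "(h has_real_derivative D) (at 0)"
    and max: "\<And>s. - d < s \<Longrightarrow> s < 0 \<Longrightarrow> h s \<le> h 0"
  shows "D \<ge> 0"
proof (rule ccontr)
  assume "\<not> D \<ge> 0"
  then obtain e where e: "e > 0" "\<And>s. 0 < s \<Longrightarrow> s < e \<Longrightarrow> h 0 < h (0 - s)"
    using DERIV_neg_dec_left[OF h] by auto
  define s where "s = min d e / 2"
  have "0 < s" "s < d" "s < e" using d e by (auto simp: s_def)
  then show False using e(2)[of s] max[of "-s"] by simp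
qed

section \<open>Mean curvature flow of graphs\<close>

abbreviation dx :: "'a::euclidean_space \<Rightarrow> ('a \<times> real \<Rightarrow> real) \<Rightarrow> 'a \<times> real \<Rightarrow> real" where
  "dx a \<equiv> dd (a, 0)"

abbreviation dt :: "('a::euclidean_space \<times> real \<Rightarrow> real) \<Rightarrow> 'a \<times> real \<Rightarrow> real" where
  "dt \<equiv> dd (0, 1)"

definition grad :: "('a::euclidean_space \<times> real \<Rightarrow> real) \<Rightarrow> 'a \<times> real \<Rightarrow> 'a" where
  "grad f z = (\<Sum>b\<in>Basis. dx b f z *\<^sub>R b)"

text \<open>
  The vectors \<open>frame p b\<close> are the columns of the square root \<open>I - p p\<^sup>T / (v (v + 1))\<close> of the coefficient matrix
  \<open>I - p p\<^sup>T / v\<^sup>2\<close>. Thus the elliptic operator, frozen at a point, is a sum of second derivatives along lines, and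
  only one-dimensional maximum tests are needed.
\<close>

definition frame :: "'a::euclidean_space \<Rightarrow> 'a \<Rightarrow> 'a" where
  "frame p b = b - ((p \<bullet> b) / (sqrt (1 + (norm p)\<^sup>2) * (sqrt (1 + (norm p)\<^sup>2) + 1))) *\<^sub>R p"

text \<open>The matrix with columns \<open>frame p b\<close> squares to
  \<open>I - p p^T / v^2\<close>. An arbitrary bilinear form lets this serve for Hessians, products
  of first derivatives and inner products alike.\<close>

lemma sum_frame:
  fixes p :: "'a::euclidean_space"
  assumes B: "bilinear B"
  shows "(\<Sum>b\<in>Basis. B (frame p b) (frame p b)) = (\<Sum>b\<in>Basis. B b b) - B p p / (1 + (norm p)\<^sup>2)"
proof -
  define v where "v = sqrt (1 + (norm p)\<^sup>2)"
  define c where "c = 1 / (v * (v + 1))"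
  have v2: "v\<^sup>2 = 1 + (norm p)\<^sup>2" by (simp add: v_def)
  have v1: "v \<ge> 1" by (simp add: v_def)
  have fr: "frame p b = b - (c * (p \<bullet> b)) *\<^sub>R p" for b
    by (simp add: frame_def v_def c_def)
  \<comment> \<open>Since \<open>|p|^2 = v^2 - 1\<close>, this is the identity
    \<open>(I - c p p^T)^2 = I - p p^T / v^2\<close>, read off at \<open>p p^T\<close>.\<close>
  have key: "2 * c - c\<^sup>2 * (v\<^sup>2 - 1) = 1 / v\<^sup>2"
  proof -
    have "c * v * (v + 1) = 1" using v1 by (simp add: c_def)
    then have "(2 * c - c\<^sup>2 * (v\<^sup>2 - 1)) * v\<^sup>2 = 1" by algebra
    then show ?thesis using v1 by (simp add: field_simps)
  qed
  have "B (frame p b) (frame p b) = B b b - c * ((p \<bullet> b) * B p b) - c * ((p \<bullet> b) * B b p)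
      + c\<^sup>2 * B p p * ((p \<bullet> b) * (p \<bullet> b))" for b
    unfolding fr bilinear_lsub[OF B] bilinear_rsub[OF B] bilinear_lmul[OF B] bilinear_rmul[OF B]
    by (simp add: algebra_simps power2_eq_square)
  then have "(\<Sum>b\<in>Basis. B (frame p b) (frame p b)) = (\<Sum>b\<in>Basis. B b b)
      - c * (\<Sum>b\<in>Basis. (p \<bullet> b) * B p b) - c * (\<Sum>b\<in>Basis. (p \<bullet> b) * B b p)
      + c\<^sup>2 * B p p * (\<Sum>b\<in>Basis. (p \<bullet> b) * (p \<bullet> b))"
    by (simp add: sum.distrib sum_subtractf sum_distrib_left)
  moreover have "(\<Sum>b\<in>Basis. (p \<bullet> b) * B p b) = B p p"
  proof -
    have "linear (B p)" using B by (simp add: bilinear_def)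
    then have "B p (\<Sum>b\<in>Basis. (p \<bullet> b) *\<^sub>R b) = (\<Sum>b\<in>Basis. (p \<bullet> b) * B p b)"
      by (simp add: linear_sum linear_scale)
    then show ?thesis by (simp add: euclidean_representation)
  qed
  moreover have "(\<Sum>b\<in>Basis. (p \<bullet> b) * B b p) = B p p"
  proof -
    have "linear (\<lambda>x. B x p)" using B by (simp add: bilinear_def)
    from linear_sum[OF this, of "\<lambda>b. (p \<bullet> b) *\<^sub>R b" Basis]
    have "B (\<Sum>b\<in>Basis. (p \<bullet> b) *\<^sub>R b) p = (\<Sum>b\<in>Basis. (p \<bullet> b) * B b p)"
      by (simp add: bilinear_lmul[OF B])
    then show ?thesis by (simp add: euclidean_representation)
  qed
  moreover have "(\<Sum>b\<in>Basis. (p \<bullet> b) * (p \<bullet> b)) = v\<^sup>2 - 1"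
    using euclidean_inner[of p p] by (simp add: v2 power2_norm_eq_inner)
  ultimately have "(\<Sum>b\<in>Basis. B (frame p b) (frame p b)) = (\<Sum>b\<in>Basis. B b b) - (2 * c - c\<^sup>2 * (v\<^sup>2 - 1)) * B p p"
    by (simp only:) (simp add: algebra_simps)
  then show ?thesis unfolding key by (simp add: v2)
qed

locale smooth_spacetime =
  fixes U :: "('a::euclidean_space \<times> real) set" and f :: "'a \<times> real \<Rightarrow> real"
  assumes openU: "open U" and smoothf: "smooth_on U f"
begin

lemma dx_inner_grad: "z \<in> U \<Longrightarrow> dx a f z = a \<bullet> grad f z"
proof -
  assume z: "z \<in> U"
  have "(a, 0) = (\<Sum>b\<in>Basis. (a \<bullet> b) *\<^sub>R (b, 0::real))"
    by (simp add: prod_eq_iff fst_sum snd_sum euclidean_representation)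
  then have "dx a f z = (\<Sum>b\<in>Basis. (a \<bullet> b) * dx b f z)"
    by (simp only: dd_sum[OF openU smoothf z] dd_scaleR[OF openU smoothf z])
  then show ?thesis by (simp add: grad_def inner_sum_right mult.commute)
qed

lemma dx_add: "z \<in> U \<Longrightarrow> dx (a + b) f z = dx a f z + dx b f z"
  and dx_scaleR: "z \<in> U \<Longrightarrow> dx (c *\<^sub>R a) f z = c * dx a f z"
  by (simp_all add: dx_inner_grad inner_add_left)

lemma norm_grad: "(norm (grad f z))\<^sup>2 = (\<Sum>b\<in>Basis. (dx b f z)\<^sup>2)"
  unfolding grad_def power2_norm_eq_inner
  by (simp add: inner_sum_left inner_sum_right inner_Basis if_distrib sum.If_cases power2_eq_square cong: if_cong)

lemma smooth_dd: "smooth_spacetime U (dd v f)"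
  by unfold_locales (auto intro: smooth_on_dd openU smoothf)

lemma commute: "z \<in> U \<Longrightarrow> dd v (dd w f) z = dd w (dd v f) z"
  using dd_commute openU smoothf by blast

text \<open>Two swaps suffice; the inner one is an identity on all of the open set \<open>U\<close>
  and may therefore be differentiated.\<close>

lemma commute3: "z \<in> U \<Longrightarrow> dd u (dd v (dd w f)) z = dd v (dd w (dd u f)) z"
proof -
  assume z: "z \<in> U"
  interpret w: smooth_spacetime U "dd w f" by (rule smooth_dd)
  interpret wu: smooth_spacetime U "dd u (dd w f)" by (rule w.smooth_dd)
  have "dd u (dd v (dd w f)) z = dd v (dd u (dd w f)) z" by (rule w.commute[OF z])
  also have "\<dots> = dd v (dd w (dd u f)) z"
    by (rule dd_cong_open[OF openU wu.smoothf z commute])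
  finally show ?thesis .
qed

lemma bilinear_hessian: "z \<in> U \<Longrightarrow> bilinear (\<lambda>a b. dx a (dx b f) z)"
proof -
  assume z: "z \<in> U"
  have l: "linear (\<lambda>a. dx a (dx b f) z)" for b
  proof -
    interpret b: smooth_spacetime U "dx b f" by (rule smooth_dd)
    show ?thesis by (rule linearI) (simp_all add: b.dx_add b.dx_scaleR z)
  qed
  have "linear (\<lambda>b. dx a (dx b f) z)" for a
    using l[of a] by (simp only: commute[OF z, of "(a,0)"])
  with l show ?thesis by (simp add: bilinear_def)
qed

lemma bilinear_dx_mult: "z \<in> U \<Longrightarrow> bilinear (\<lambda>a b. dx a f z * dx b f z)"
  by (simp add: bilinear_def linear_iff dx_add dx_scaleR algebra_simps)

lemma line: "(x + s *\<^sub>R a, t) \<in> U \<Longrightarrow>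
   ((\<lambda>s. f (x + s *\<^sub>R a, t)) has_real_derivative dx a f (x + s *\<^sub>R a, t)) (at s)"
  using DERIV_line[OF openU smoothf, of "(x, t)" s "(a, 0)"] by simp

lemma time_line: "(x, t) \<in> U \<Longrightarrow> ((\<lambda>t. f (x, t)) has_real_derivative dt f (x, t)) (at t)"
  using DERIV_line[OF openU smoothf, of "(x, 0)" t "(0, 1)"] by simp

lemma has_derivative_slice:
  assumes z: "(x, t) \<in> U"
  shows "((\<lambda>y. f (y, t)) has_derivative (\<lambda>a. dx a f (x, t))) (at x)"
proof -
  have "(f has_derivative frechet_derivative f (at (x, t))) (at (x, t))"
    using smooth_on_differentiable[OF openU smoothf z] frechet_derivative_works by blast
  moreover have "((\<lambda>y. (y, t)) has_derivative (\<lambda>a. (a, 0))) (at x)"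
    by (auto intro!: derivative_eq_intros)
  ultimately show ?thesis
    using diff_chain_at[of "\<lambda>y. (y, t)" "\<lambda>a. (a, 0)" x f] by (simp add: o_def dd_def)
qed

lemma gradient_slice:
  assumes z: "(x, t) \<in> U"
  shows "gradient (\<lambda>y. f (y, t)) x = grad f (x, t)"
  using frechet_derivative_at[OF has_derivative_slice[OF z], symmetric]
  by (simp add: gradient_def grad_def)

end

section \<open>The flow equation in nondivergence form\<close>

definition mean_curvature_speed :: "('a::euclidean_space \<times> real \<Rightarrow> real) \<Rightarrow> 'a \<times> real \<Rightarrow> real" where
  "mean_curvature_speed f z = (\<Sum>b\<in>Basis. dx b (dx b f) z) -
     (\<Sum>b\<in>Basis. \<Sum>c\<in>Basis. dx b f z * dx c f z * dx b (dx c f) z) / (1 + (\<Sum>b\<in>Basis. (dx b f z)\<^sup>2))"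

context smooth_spacetime
begin

text \<open>The quotient rule gives \<open>div (p / V) = (tr D^2 f - p^T D^2 f p / V^2) / V\<close>,
  and the outer factor cancels the last division.\<close>

lemma divergence_slice:
  assumes z: "(x, t) \<in> U"
  shows "sqrt (1 + (norm (grad f (x, t)))\<^sup>2) *
     divergence (\<lambda>y. gradient (\<lambda>y. f (y, t)) y /\<^sub>R sqrt (1 + (norm (gradient (\<lambda>y. f (y, t)) y))\<^sup>2)) x
     = mean_curvature_speed f (x, t)"
proof -
  define V where "V = (\<lambda>y. sqrt (1 + (\<Sum>b\<in>Basis. (dx b f (y, t))\<^sup>2)))"
  define F where "F = (\<lambda>y. \<Sum>c\<in>Basis. (dx c f (y, t) / V y) *\<^sub>R c)"
  define Q where "Q = (\<Sum>b\<in>Basis. (dx b f (x, t))\<^sup>2)"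
  have Q0: "Q \<ge> 0" unfolding Q_def by (simp add: sum_nonneg)
  have dp: "((\<lambda>y. dx c f (y, t)) has_derivative (\<lambda>a. dx a (dx c f) (x, t))) (at x)" for c
  proof -
    interpret c: smooth_spacetime U "dx c f" by (rule smooth_dd)
    show ?thesis by (rule c.has_derivative_slice[OF z])
  qed
  have dV: "(V has_derivative (\<lambda>a. (\<Sum>d\<in>Basis. dx d f (x, t) * dx a (dx d f) (x, t)) / V x)) (at x)"
    unfolding V_def using Q0 unfolding Q_def
    by (auto intro!: derivative_eq_intros dp simp: sum_distrib_left sum_divide_distrib divide_simps mult.commute)
  have Vx: "V x > 0" using Q0 by (simp add: V_def Q_def)
  define F' where "F' = (\<lambda>a. \<Sum>c\<in>Basis. (dx a (dx c f) (x, t) / V x -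
      dx c f (x, t) * ((\<Sum>d\<in>Basis. dx d f (x, t) * dx a (dx d f) (x, t)) / V x) / (V x * V x)) *\<^sub>R c)"
  have dF: "(F has_derivative F') (at x)"
    unfolding F_def F'_def using Vx
    by (auto intro!: derivative_eq_intros dp dV simp: divide_simps mult.assoc)
  have op: "open ((\<lambda>y. (y, t)) -` U)"
    by (rule open_vimage[OF openU]) (auto intro!: continuous_intros)
  have eq: "F y = gradient (\<lambda>y. f (y, t)) y /\<^sub>R sqrt (1 + (norm (gradient (\<lambda>y. f (y, t)) y))\<^sup>2)"
    if "y \<in> (\<lambda>y. (y, t)) -` U" for y
    using that by (simp add: gradient_slice norm_grad F_def V_def) (simp add: grad_def scaleR_sum_right divide_inverse mult.commute)
  have "((\<lambda>y. gradient (\<lambda>y. f (y, t)) y /\<^sub>R sqrt (1 + (norm (gradient (\<lambda>y. f (y, t)) y))\<^sup>2)) has_derivative F') (at x)"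
    by (rule has_derivative_transform_within_open[OF dF op _ eq]) (use z in auto)
  note fd = frechet_derivative_at[OF this, symmetric]
  have div: "divergence (\<lambda>y. gradient (\<lambda>y. f (y, t)) y /\<^sub>R sqrt (1 + (norm (gradient (\<lambda>y. f (y, t)) y))\<^sup>2)) x
     = (\<Sum>b\<in>Basis. F' b \<bullet> b)" by (simp add: divergence_def fd)
  have "(\<Sum>b\<in>Basis. F' b \<bullet> b) = (\<Sum>b\<in>Basis. dx b (dx b f) (x, t) / V x -
      dx b f (x, t) * ((\<Sum>d\<in>Basis. dx d f (x, t) * dx b (dx d f) (x, t)) / V x) / (V x * V x))"
    by (rule sum.cong) (simp_all only: F'_def inner_sum_left_Basis)
  then have "V x * (\<Sum>b\<in>Basis. F' b \<bullet> b) = (\<Sum>b\<in>Basis. dx b (dx b f) (x, t) -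
      dx b f (x, t) * (\<Sum>d\<in>Basis. dx d f (x, t) * dx b (dx d f) (x, t)) / (V x * V x))"
    using Vx by (simp add: sum_distrib_left) (intro sum.cong, auto simp: field_simps sum_distrib_left)
  also have "\<dots> = mean_curvature_speed f (x, t)"
  proof -
    have "V x * V x = 1 + Q" using Q0 by (simp add: V_def Q_def)
    then show ?thesis
      by (simp add: mean_curvature_speed_def sum_subtractf Q_def sum_divide_distrib sum_distrib_left mult.assoc)
  qed
  finally show ?thesis unfolding div by (simp add: V_def norm_grad)
qed

end

locale mcf_graph = smooth_spacetime +
  assumes flow: "z \<in> U \<Longrightarrow> dt f z = mean_curvature_speed f z"

text \<open>On the open time interval the one-sided time derivative is the ordinary one. From here
  on the initial time enters only through continuity.\<close>

lemma graph_flow_imp_mcf_graph: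
  fixes u :: "'a::euclidean_space \<Rightarrow> real \<Rightarrow> real"
  assumes g: "graph_flows_by_mean_curvature R T u"
  shows "mcf_graph (ball 0 R \<times> {0<..<T}) (\<lambda>(x, t). u x t)"
proof -
  let ?U = "ball (0::'a) R \<times> {0<..<T}" and ?f = "\<lambda>(x, t). u x t"
  interpret smooth_spacetime ?U ?f
  proof
    show "open ?U" by (simp add: open_Times)
    show "smooth_on ?U ?f"
      using g unfolding graph_flows_by_mean_curvature_def
      by (auto intro: smooth_on_subset)
  qed
  show ?thesis
  proof
    fix z assume zU: "z \<in> ?U"
    obtain x t where z: "z = (x, t)" by force
    have xt: "x \<in> ball 0 R" "0 < t" "t < T" "(x, t) \<in> ?U" using zU z by auto
    have "((\<lambda>s. u x s) has_real_derivative mean_curvature_speed ?f (x, t)) (at t within {0..T})"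
    proof -
      have "0 \<le> t" "t \<le> T" using xt by auto
      then show ?thesis
        using g[unfolded graph_flows_by_mean_curvature_def, THEN conjunct2, rule_format, of x t]
          xt(1) divergence_slice[OF xt(4)] gradient_slice[OF xt(4)] by simp
    qed
    then have "((\<lambda>s. u x s) has_real_derivative mean_curvature_speed ?f (x, t)) (at t)"
      using at_within_interior[of t "{0..T}"] xt by auto
    then show "dt ?f z = mean_curvature_speed ?f z"
      using time_line[OF xt(4)] z DERIV_unique by fastforce
  qed
qed

context mcf_graph
begin

lemma flow_frame:
  assumes z: "z \<in> U"
  shows "dt f z = (\<Sum>b\<in>Basis. dx (frame (grad f z) b) (dx (frame (grad f z) b) f) z)"
proof -
  let ?p = "grad f z"
  have "dx ?p (dx ?p f) z = (\<Sum>b\<in>Basis. \<Sum>c\<in>Basis. dx b f z * dx c f z * dx b (dx c f) z)"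
    using bilinear_sum[OF bilinear_hessian[OF z], of "\<lambda>b. dx b f z *\<^sub>R b" Basis "\<lambda>b. dx b f z *\<^sub>R b" Basis]
    by (simp add: grad_def[symmetric] bilinear_lmul[OF bilinear_hessian[OF z]] bilinear_rmul[OF bilinear_hessian[OF z]] sum.cartesian_product mult_ac)
  then show ?thesis
    unfolding sum_frame[OF bilinear_hessian[OF z]] flow[OF z] mean_curvature_speed_def
    by (simp add: norm_grad)
qed

text \<open>
  The fixed direction \<open>e\<close> is parallel to the gradient at \<open>z\<close> only. Near a maximum of an expression in \<open>|du|\<close> the function
  \<open>|du|\<close> may be replaced by \<open>dx e f\<close>, which agrees with it at \<open>z\<close> and is no larger in absolute value elsewhere.
\<close>

lemma directional_derivative_flow:
  assumes z: "z \<in> U" and p: "grad f z = m *\<^sub>R e" and e: "norm e = 1"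
  defines "\<phi> \<equiv> dx e f" and "w \<equiv> frame (grad f z)"
  shows "dt \<phi> z = (\<Sum>b\<in>Basis. dx (w b) (dx (w b) \<phi>) z)
     - 2 * m / (1 + m\<^sup>2) * (\<Sum>b\<in>Basis. (dx (w b) \<phi> z)\<^sup>2)"
proof -
  let ?p = "grad f z"
  obtain x t where xt: "z = (x, t)" by force
  interpret phi: smooth_spacetime U \<phi> unfolding \<phi>_def by (rule smooth_dd)
  interpret ft: smooth_spacetime U "dt f" by (rule smooth_dd)
  have at0: "(x + 0 *\<^sub>R e, t) \<in> U" using z xt by simp
  \<comment> \<open>The flow equation is differentiated along \<open>e\<close> at \<open>z\<close>;
    commuting derivatives turns those of \<open>f\<close> into those of
    \<open>\<phi>\<close>.\<close>
  have d1: "((\<lambda>s. dx b f (x + s *\<^sub>R e, t)) has_real_derivative dx b \<phi> z) (at 0)" for b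
  proof -
    interpret b: smooth_spacetime U "dx b f" by (rule smooth_dd)
    show ?thesis using b.line[OF at0] commute[OF z, of "(e,0)" "(b,0)"] by (simp add: xt \<phi>_def)
  qed
  have d2: "((\<lambda>s. dx b (dx c f) (x + s *\<^sub>R e, t)) has_real_derivative dx b (dx c \<phi>) z) (at 0)" for b c
  proof -
    interpret c: smooth_spacetime U "dx c f" by (rule smooth_dd)
    interpret b: smooth_spacetime U "dx b (dx c f)" by (rule c.smooth_dd)
    show ?thesis using b.line[OF at0] commute3[OF z, of "(e,0)" "(b,0)" "(c,0)"] by (simp add: xt \<phi>_def)
  qed
  have d3: "((\<lambda>s. dt f (x + s *\<^sub>R e, t)) has_real_derivative dt \<phi> z) (at 0)"
    using ft.line[OF at0] commute[OF z, of "(e,0)" "(0,1)"] by (simp add: xt \<phi>_def)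
  define Q where "Q = 1 + (\<Sum>b\<in>Basis. (dx b f z)\<^sup>2)"
  define N where "N = (\<Sum>b\<in>Basis. \<Sum>c\<in>Basis. dx b f z * dx c f z * dx b (dx c f) z)"
  define Q' where "Q' = (\<Sum>b\<in>Basis. 2 * dx b f z * dx b \<phi> z)"
  define N' where "N' = (\<Sum>b\<in>Basis. \<Sum>c\<in>Basis. dx b \<phi> z * dx c f z * dx b (dx c f) z
       + dx b f z * dx c \<phi> z * dx b (dx c f) z + dx b f z * dx c f z * dx b (dx c \<phi>) z)"
  have Q0: "Q > 0" unfolding Q_def by (simp add: add_pos_nonneg sum_nonneg)
  have dN: "((\<lambda>s. \<Sum>b\<in>Basis. \<Sum>c\<in>Basis. dx b f (x + s *\<^sub>R e, t) * dx c f (x + s *\<^sub>R e, t) * dx b (dx c f) (x + s *\<^sub>R e, t))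
      has_real_derivative N') (at 0)"
    unfolding N'_def by (rule derivative_eq_intros d1 d2 refl | simp add: xt algebra_simps)+
  have dQ: "((\<lambda>s. 1 + (\<Sum>b\<in>Basis. (dx b f (x + s *\<^sub>R e, t))\<^sup>2)) has_real_derivative Q') (at 0)"
    unfolding Q'_def by (auto intro!: derivative_eq_intros d1 simp: xt algebra_simps)
  have dS: "((\<lambda>s. \<Sum>b\<in>Basis. dx b (dx b f) (x + s *\<^sub>R e, t)) has_real_derivative (\<Sum>b\<in>Basis. dx b (dx b \<phi>) z)) (at 0)"
    by (intro derivative_intros d2)
  have "((\<lambda>s. mean_curvature_speed f (x + s *\<^sub>R e, t)) has_real_derivative
      (\<Sum>b\<in>Basis. dx b (dx b \<phi>) z) - (N' * Q - N * Q') / (Q * Q)) (at 0)"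
    unfolding mean_curvature_speed_def
    using DERIV_diff[OF dS DERIV_divide[OF dN dQ]] Q0 by (simp add: xt N_def Q_def)
  moreover have "open ((\<lambda>s. (x + s *\<^sub>R e, t)) -` U)"
    by (rule open_vimage[OF openU]) (auto intro!: continuous_intros)
  ultimately have "((\<lambda>s. dt f (x + s *\<^sub>R e, t)) has_real_derivative
      (\<Sum>b\<in>Basis. dx b (dx b \<phi>) z) - (N' * Q - N * Q') / (Q * Q)) (at 0)"
    by (rule has_field_derivative_transform_within_open) (use z xt in \<open>auto simp: flow\<close>)
  then have dtphi: "dt \<phi> z = (\<Sum>b\<in>Basis. dx b (dx b \<phi>) z) - (N' * Q - N * Q') / (Q * Q)"
    using DERIV_unique d3 by blast
  have Qp: "Q = 1 + (norm ?p)\<^sup>2" by (simp add: Q_def norm_grad)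
  have np: "(norm ?p)\<^sup>2 = m\<^sup>2" by (simp add: p e)
  \<comment> \<open>As \<open>grad f z\<close> is \<open>m\<close> times \<open>e\<close>,
    contracting the Hessian of \<open>f\<close> with it yields \<open>m\<close> times the gradient
    of \<open>\<phi>\<close>.\<close>
  have k1: "(\<Sum>c\<in>Basis. dx c f z * dx b (dx c f) z) = m * dx b \<phi> z" for b
  proof -
    interpret b: smooth_spacetime U "dx b f" by (rule smooth_dd)
    have "(\<Sum>c\<in>Basis. dx c f z * dx b (dx c f) z) = (\<Sum>c\<in>Basis. dx c f z * dx c (dx b f) z)"
      using commute[OF z] by simp
    also have "\<dots> = ?p \<bullet> grad (dx b f) z"
      by (simp add: b.dx_inner_grad[OF z] grad_def[of f] inner_sum_left)
    also have "\<dots> = m * dx e (dx b f) z" unfolding p by (simp add: b.dx_inner_grad[OF z])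
    also have "\<dots> = m * dx b \<phi> z" using commute[OF z] by (simp add: \<phi>_def)
    finally show ?thesis .
  qed
  have k2: "(\<Sum>b\<in>Basis. dx b f z * dx b \<phi> z) = dx ?p \<phi> z"
    by (simp add: phi.dx_inner_grad[OF z] grad_def[of f] inner_sum_left)
  have k3: "dx ?p (dx ?p \<phi>) z = (\<Sum>b\<in>Basis. \<Sum>c\<in>Basis. dx b f z * dx c f z * dx b (dx c \<phi>) z)"
    using bilinear_sum[OF phi.bilinear_hessian[OF z], of "\<lambda>b. dx b f z *\<^sub>R b" Basis "\<lambda>b. dx b f z *\<^sub>R b" Basis]
    by (simp add: grad_def[symmetric] bilinear_lmul[OF phi.bilinear_hessian[OF z]] bilinear_rmul[OF phi.bilinear_hessian[OF z]] sum.cartesian_product mult_ac)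
  have N: "N = m * dx ?p \<phi> z"
  proof -
    have "N = (\<Sum>b\<in>Basis. dx b f z * (\<Sum>c\<in>Basis. dx c f z * dx b (dx c f) z))"
      by (simp add: N_def sum_distrib_left mult.assoc)
    also have "\<dots> = m * (\<Sum>b\<in>Basis. dx b f z * dx b \<phi> z)"
      by (simp add: k1 sum_distrib_left algebra_simps)
    finally show ?thesis by (simp add: k2)
  qed
  have Q': "Q' = 2 * dx ?p \<phi> z"
    by (simp add: Q'_def k2[symmetric] sum_distrib_left mult.assoc)
  have N': "N' = 2 * m * (\<Sum>b\<in>Basis. (dx b \<phi> z)\<^sup>2) + dx ?p (dx ?p \<phi>) z"
  proof -
    have a: "(\<Sum>b\<in>Basis. \<Sum>c\<in>Basis. dx b \<phi> z * dx c f z * dx b (dx c f) z) = m * (\<Sum>b\<in>Basis. (dx b \<phi> z)\<^sup>2)"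
    proof -
      have "(\<Sum>b\<in>Basis. \<Sum>c\<in>Basis. dx b \<phi> z * dx c f z * dx b (dx c f) z) =
         (\<Sum>b\<in>Basis. dx b \<phi> z * (\<Sum>c\<in>Basis. dx c f z * dx b (dx c f) z))"
        by (simp add: sum_distrib_left mult.assoc)
      then show ?thesis by (simp add: k1 sum_distrib_left power2_eq_square algebra_simps)
    qed
    have "(\<Sum>b\<in>Basis. \<Sum>c\<in>Basis. dx b f z * dx c \<phi> z * dx b (dx c f) z)
       = (\<Sum>c\<in>Basis. \<Sum>b\<in>Basis. dx c \<phi> z * dx b f z * dx c (dx b f) z)"
      by (subst sum.swap, intro sum.cong refl) (metis commute[OF z] mult.commute)
    with a show ?thesis
      unfolding N'_def sum.distrib k3 by simp
  qed
  have s1: "(\<Sum>b\<in>Basis. dx (w b) (dx (w b) \<phi>) z) = (\<Sum>b\<in>Basis. dx b (dx b \<phi>) z) - dx ?p (dx ?p \<phi>) z / Q"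
    unfolding w_def sum_frame[OF phi.bilinear_hessian[OF z]] Qp ..
  \<comment> \<open>The squared gradient of \<open>\<phi>\<close> in \<open>N'\<close> and the
    product \<open>N * Q'\<close> combine to a multiple of exactly this sum.\<close>
  have s2: "(\<Sum>b\<in>Basis. (dx (w b) \<phi> z)\<^sup>2) = (\<Sum>b\<in>Basis. (dx b \<phi> z)\<^sup>2) - (dx ?p \<phi> z)\<^sup>2 / Q"
    unfolding w_def power2_eq_square[of "dx _ \<phi> z"] sum_frame[OF phi.bilinear_dx_mult[OF z]] Qp ..
  have mQ: "1 + m\<^sup>2 = Q" using Qp np by simp
  show ?thesis
    unfolding dtphi s1 s2 N N' Q' mQ using Q0 by (simp add: field_simps power2_eq_square)
qed

end

section \<open>Maximum principles\<close>

text \<open>The line through \<open>(x, t)\<close> along \<open>a\<close> meets \<open>W\<close> in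
  an open set of parameters, so the one-variable test applies. Only times up to \<open>t\<close> are
  compared, since the maximum may sit at the final time.\<close>

lemma spatial_max:
  fixes G :: "'a::real_normed_vector \<times> real \<Rightarrow> real"
  assumes W: "open W" "(x, t) \<in> W" and max: "\<And>z. z \<in> W \<Longrightarrow> snd z \<le> t \<Longrightarrow> G z \<le> G (x, t)"
    and h: "\<And>s. (x + s *\<^sub>R a, t) \<in> W \<Longrightarrow> ((\<lambda>s. G (x + s *\<^sub>R a, t)) has_real_derivative h1 s) (at s)"
    and h1: "(h1 has_real_derivative D) (at 0)"
  shows "h1 0 = 0" "D \<le> 0"
proof -
  have "open ((\<lambda>s. (x + s *\<^sub>R a, t)) -` W)"
    by (rule open_vimage[OF W(1)]) (auto intro!: continuous_intros)
  moreover have "0 \<in> (\<lambda>s. (x + s *\<^sub>R a, t)) -` W" using W by simp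
  ultimately obtain d where d: "d > 0" "ball 0 d \<subseteq> (\<lambda>s. (x + s *\<^sub>R a, t)) -` W"
    using open_contains_ball by blast
  then have i: "(x + s *\<^sub>R a, t) \<in> W" if "\<bar>s\<bar> < d" for s using that by (auto simp: subset_iff)
  show "h1 0 = 0" "D \<le> 0"
    using local_max_second_derivative[OF d(1) h h1] max i by auto
qed

lemma temporal_max:
  fixes G :: "'a::real_normed_vector \<times> real \<Rightarrow> real"
  assumes W: "open W" "(x, t) \<in> W" and max: "\<And>z. z \<in> W \<Longrightarrow> snd z \<le> t \<Longrightarrow> G z \<le> G (x, t)"
    and h: "((\<lambda>s. G (x, s)) has_real_derivative D) (at t)"
  shows "D \<ge> 0"
proof -
  have "open ((\<lambda>s. (x, t + s)) -` W)"
    by (rule open_vimage[OF W(1)]) (auto intro!: continuous_intros)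
  moreover have "0 \<in> (\<lambda>s. (x, t + s)) -` W" using W by simp
  ultimately obtain d where d: "d > 0" "ball 0 d \<subseteq> (\<lambda>s. (x, t + s)) -` W"
    using open_contains_ball by blast
  have "((\<lambda>s. G (x, t + s)) has_real_derivative D) (at 0)"
    using h DERIV_shift[of "\<lambda>s. G (x, s)" D 0 t] by (simp add: add.commute)
  then show ?thesis
    by (rule left_max_derivative[OF d(1)]) (use max d in \<open>auto simp: subset_iff\<close>)
qed

section \<open>Traces of the coefficient matrix and the height bound by spheres\<close>

lemma sum_frame_inner:
  fixes p :: "'a::euclidean_space"
  shows "(\<Sum>b\<in>Basis. (frame p b \<bullet> x) * (frame p b \<bullet> y)) = x \<bullet> y - (p \<bullet> x) * (p \<bullet> y) / (1 + (norm p)\<^sup>2)"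
proof -
  have "bilinear (\<lambda>a b. (a \<bullet> x) * (b \<bullet> y))"
    by (simp add: bilinear_def linear_iff inner_add_left algebra_simps)
  from sum_frame[OF this, of p] show ?thesis by (simp add: euclidean_inner[of x y] inner_commute)
qed

lemma sum_frame_norm:
  fixes p :: "'a::euclidean_space"
  shows "(\<Sum>b\<in>Basis. frame p b \<bullet> frame p b) = real DIM('a) - (norm p)\<^sup>2 / (1 + (norm p)\<^sup>2)"
proof -
  have "bilinear (\<lambda>a b::'a. a \<bullet> b)"
    by (simp add: bilinear_def linear_iff inner_add_left inner_add_right)
  from sum_frame[OF this, of p] show ?thesis by (simp add: inner_same_Basis power2_norm_eq_inner)
qed

text \<open>The coefficient matrix sends \<open>p\<close> to \<open>p / (1 + |p|^2)\<close>. Hence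
  the square of \<open>p\<close> for it is \<open>|p|^2 / (1 + |p|^2)\<close>, close to 1 where the
  graph is steep.\<close>

lemma sum_frame_inner_self:
  fixes p :: "'a::euclidean_space"
  shows "(\<Sum>b\<in>Basis. (frame p b \<bullet> p) * (frame p b \<bullet> x)) = (p \<bullet> x) / (1 + (norm p)\<^sup>2)"
proof -
  have "1 + (norm p)\<^sup>2 > 0" by (simp add: add_pos_nonneg)
  then show ?thesis
    unfolding sum_frame_inner power2_norm_eq_inner by (simp add: field_simps)
qed

text \<open>The right-hand side solves the linear equation with the coefficients of the flow, so it
  is smallest initially or where \<open>|x| = \<rho>\<close>, and there it is at least
  \<open>\<rho>^2\<close>.\<close>

lemma avoids_shrinking_sphere:
  fixes f :: "'a::euclidean_space \<times> real \<Rightarrow> real"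
  assumes mcf: "mcf_graph (ball 0 R \<times> {0<..<T}) f" and cont: "continuous_on (ball 0 R \<times> {0..<T}) f"
    and rho: "0 < \<rho>" "\<rho> < R" and init: "\<And>x. norm x \<le> \<rho> \<Longrightarrow> \<rho>\<^sup>2 \<le> (f (x, 0) - A)\<^sup>2"
    and xt: "norm x \<le> \<rho>" "0 \<le> t" "t < T"
  shows "\<rho>\<^sup>2 \<le> (norm x)\<^sup>2 + (f (x, t) - A)\<^sup>2 + 2 * real DIM('a) * t"
proof (rule field_le_epsilon)
  interpret mcf_graph "ball 0 R \<times> {0<..<T}" f by (rule mcf)
  fix e :: real assume e0: "e > 0"
  define e' where "e' = e / (t + 1)"
  have e: "e' > 0" "e' * t \<le> e" using e0 xt by (auto simp: e'_def field_simps)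
  \<comment> \<open>The sign turns the minimum into a maximum. The extra \<open>e' * snd z\<close>
    makes the inequality strict and costs at most \<open>e\<close> at time \<open>t\<close>.\<close>
  define G where "G = (\<lambda>z::'a \<times> real. - (fst z \<bullet> fst z + (f z - A)\<^sup>2 + (2 * real DIM('a) + e') * snd z))"
  define K where "K = cball (0::'a) \<rho> \<times> {0..t}"
  have K: "compact K" "(x, t) \<in> K" "K \<subseteq> ball 0 R \<times> {0..<T}"
    unfolding K_def using xt rho by (auto intro: compact_Times)
  have "continuous_on K G"
    unfolding G_def by (intro continuous_intros continuous_on_subset[OF cont K(3)])
  then obtain z0 where z0: "z0 \<in> K" "\<And>z. z \<in> K \<Longrightarrow> G z \<le> G z0"
    using continuous_attains_sup[OF K(1)] K(2) by blast
  obtain x0 t0 where z0_eq: "z0 = (x0, t0)" by force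
  have "G z0 \<le> - \<rho>\<^sup>2"
  proof (cases "t0 = 0 \<or> norm x0 = \<rho>")
    case True
    have t0: "t0 \<ge> 0" and x0: "norm x0 \<le> \<rho>" using z0 by (auto simp: K_def z0_eq)
    have "0 \<le> (2 * real DIM('a) + e') * t0" using t0 e by simp
    moreover have "\<rho>\<^sup>2 \<le> x0 \<bullet> x0 + (f (x0, t0) - A)\<^sup>2"
      using True init[OF x0] by (auto simp: power2_norm_eq_inner[symmetric] intro: order_trans)
    ultimately show ?thesis by (simp add: G_def z0_eq)
  next
    case False
    define W where "W = ball (0::'a) \<rho> \<times> {0<..<T}"
    have W: "open W" "(x0, t0) \<in> W"
      using z0 False xt by (auto simp: W_def K_def z0_eq open_Times)
    have WU: "W \<subseteq> ball 0 R \<times> {0<..<T}" using rho by (auto simp: W_def)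
    have zU: "(x0, t0) \<in> ball 0 R \<times> {0<..<T}" using W WU by blast
    have max: "G z \<le> G (x0, t0)" if "z \<in> W" "snd z \<le> t0" for z
      using that z0 by (intro z0(2)[unfolded z0_eq]) (auto simp: W_def K_def z0_eq)
    define p where "p = grad f (x0, t0)"
    define F where "F = f (x0, t0) - A"
    have sp: "0 \<le> frame p b \<bullet> frame p b + (dx (frame p b) f (x0, t0))\<^sup>2
         + F * dx (frame p b) (dx (frame p b) f) (x0, t0)" for b
    proof -
      define w where "w = frame p b"
      interpret w: smooth_spacetime "ball 0 R \<times> {0<..<T}" "dx w f" by (rule smooth_dd)
      have h: "((\<lambda>s. G (x0 + s *\<^sub>R w, t0)) has_real_derivative
          - (2 * ((x0 + s *\<^sub>R w) \<bullet> w) + 2 * (f (x0 + s *\<^sub>R w, t0) - A) * dx w f (x0 + s *\<^sub>R w, t0))) (at s)"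
        if "(x0 + s *\<^sub>R w, t0) \<in> W" for s
        unfolding G_def using that WU
        by (auto intro!: derivative_eq_intros line simp: inner_commute algebra_simps)
      have "((\<lambda>s. - (2 * ((x0 + s *\<^sub>R w) \<bullet> w) + 2 * (f (x0 + s *\<^sub>R w, t0) - A) * dx w f (x0 + s *\<^sub>R w, t0)))
          has_real_derivative - (2 * (w \<bullet> w) + 2 * (dx w f (x0, t0))\<^sup>2 + 2 * F * dx w (dx w f) (x0, t0))) (at 0)"
        using zU by (auto intro!: derivative_eq_intros line w.line simp: F_def power2_eq_square algebra_simps)
      from spatial_max(2)[OF W max h this] show ?thesis by (simp add: w_def)
    qed
    have "0 \<le> (\<Sum>b\<in>Basis. frame p b \<bullet> frame p b + (dx (frame p b) f (x0, t0))\<^sup>2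
         + F * dx (frame p b) (dx (frame p b) f) (x0, t0))"
      by (intro sum_nonneg sp)
    \<comment> \<open>The first two terms have traces \<open>n - |p|^2 / v^2\<close> and
      \<open>|p|^2 / v^2\<close>, which add up to \<open>n\<close>.\<close>
    also have "\<dots> = real DIM('a) + F * dt f (x0, t0)"
      unfolding sum.distrib sum_frame_norm sum_distrib_left[symmetric] flow_frame[OF zU] p_def[symmetric]
      unfolding dx_inner_grad[OF zU] p_def[symmetric] power2_eq_square[of "frame p _ \<bullet> p"] sum_frame_inner_self
      by (simp add: power2_norm_eq_inner)
    finally have s: "0 \<le> real DIM('a) + F * dt f (x0, t0)" .
    have "((\<lambda>s. G (x0, s)) has_real_derivative - (2 * F * dt f (x0, t0) + (2 * real DIM('a) + e'))) (at t0)"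
      unfolding G_def using zU by (auto intro!: derivative_eq_intros time_line simp: F_def)
    \<comment> \<open>The time test gives \<open>2 F f_t + 2 n + e' \<le> 0\<close>, against
      \<open>0 \<le> n + F f_t\<close>.\<close>
    from temporal_max[OF W max this] s e have False by (simp add: algebra_simps)
    then show ?thesis ..
  qed
  then have "\<rho>\<^sup>2 \<le> - G (x, t)" using z0(2)[OF K(2)] by linarith
  also have "\<dots> \<le> (norm x)\<^sup>2 + (f (x, t) - A)\<^sup>2 + 2 * real DIM('a) * t + e"
    using e(2) by (simp add: G_def power2_norm_eq_inner algebra_simps)
  finally show "\<rho>\<^sup>2 \<le> (norm x)\<^sup>2 + (f (x, t) - A)\<^sup>2 + 2 * real DIM('a) * t + e" .
qed

text \<open>Open balls of radius \<open>\<rho>\<close> centred at heights \<open>M + \<rho>\<close>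
  and \<open>- (M + \<rho>)\<close> miss the initial graph. While
  \<open>|x|^2 + 2 n t < \<rho>^2\<close>, the height over \<open>x\<close> cannot equal that of a
  centre, and continuity in time prevents crossing it.\<close>

lemma height_bound:
  fixes f :: "'a::euclidean_space \<times> real \<Rightarrow> real"
  assumes mcf: "mcf_graph (ball 0 R \<times> {0<..<T}) f" and cont: "continuous_on (ball 0 R \<times> {0..<T}) f"
    and rho: "0 < \<rho>" "\<rho> < R" and init: "\<And>x. norm x \<le> \<rho> \<Longrightarrow> \<bar>f (x, 0)\<bar> \<le> M"
    and t: "0 \<le> t" "t < T" and x: "(norm x)\<^sup>2 + 2 * real DIM('a) * t < \<rho>\<^sup>2"
  shows "\<bar>f (x, t)\<bar> \<le> M + \<rho>"
proof -
  have "(norm x)\<^sup>2 \<le> \<rho>\<^sup>2" using x t by (smt (verit) mult_nonneg_nonneg of_nat_0_le_iff)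
  then have nx: "norm x \<le> \<rho>" using rho by (simp add: power2_le_iff_abs_le)
  have ne: "f (x, s) \<noteq> A" if s: "0 \<le> s" "s \<le> t" and A: "\<bar>A\<bar> = M + \<rho>" for s A
  proof
    assume eq: "f (x, s) = A"
    have "\<rho>\<^sup>2 \<le> (f (y, 0) - A)\<^sup>2" if "norm y \<le> \<rho>" for y
      using init[OF that] A rho by (intro power2_le_iff_abs_le[THEN iffD2, of _ \<rho>, THEN order_trans] abs_le_square_iff[THEN iffD1]) linarith+
    from avoids_shrinking_sphere[OF mcf cont rho this nx s(1)] s t eq
    have "\<rho>\<^sup>2 \<le> (norm x)\<^sup>2 + 2 * real DIM('a) * s" by simp
    moreover have "2 * real DIM('a) * s \<le> 2 * real DIM('a) * t" using s by (intro mult_left_mono) auto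
    ultimately show False using x by linarith
  qed
  have c: "continuous_on {0..t} (\<lambda>s. f (x, s))"
    by (rule continuous_on_compose2[OF cont]) (use nx rho t in \<open>auto intro!: continuous_intros\<close>)
  have "f (x, t) \<le> M + \<rho>"
  proof (rule ccontr)
    assume "\<not> ?thesis"
    then obtain s where "0 \<le> s" "s \<le> t" "f (x, s) = M + \<rho>"
      using IVT'[of "\<lambda>s. f (x, s)" 0 "M + \<rho>" t, OF _ _ _ c] init[OF nx] rho t by force
    then show False using ne[of s "M + \<rho>"] init[OF nx] rho by linarith
  qed
  moreover have "f (x, t) \<ge> - (M + \<rho>)"
  proof (rule ccontr)
    assume "\<not> ?thesis"
    then obtain s where "0 \<le> s" "s \<le> t" "f (x, s) = - (M + \<rho>)"
      using IVT2'[of "\<lambda>s. f (x, s)" t "- (M + \<rho>)" 0, OF _ _ _ c] init[OF nx] rho t by force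
    then show False using ne[of s "- (M + \<rho>)"] init[OF nx] rho by linarith
  qed
  ultimately show ?thesis by linarith
qed

section \<open>Korevaar's interior gradient estimate\<close>

text \<open>
  For \<open>h = \<eta>\<^sup>2 (1 + \<phi>\<^sup>2)\<close> on a line, with \<open>m\<close> the value of \<open>\<phi>\<close> and indices 1, 2 marking derivatives at the maximum:
  the condition \<open>h' = 0\<close> eliminates \<open>\<eta>1\<close> from \<open>h'' \<le> 0\<close>.
\<close>

lemma product_max_combine:
  fixes \<eta> \<eta>1 \<eta>2 m \<phi>1 \<phi>2 W :: real
  assumes "\<eta> > 0" and W: "W = 1 + m\<^sup>2"
    and first: "2 * \<eta> * \<eta>1 * W + 2 * \<eta>\<^sup>2 * m * \<phi>1 = 0"
    and second: "2 * \<eta>1\<^sup>2 * W + 2 * \<eta> * \<eta>2 * W + 8 * \<eta> * \<eta>1 * m * \<phi>1 + 2 * \<eta>\<^sup>2 * \<phi>1\<^sup>2 + 2 * \<eta>\<^sup>2 * m * \<phi>2 \<le> 0"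
  shows "W * (W * \<eta>2 + \<eta> * m * \<phi>2) + \<eta> * (W - 3 * m\<^sup>2) * \<phi>1\<^sup>2 \<le> 0"
proof -
  have W0: "W > 0" using W by (simp add: add_pos_nonneg)
  have "2 * \<eta> * (\<eta>1 * W + \<eta> * m * \<phi>1) = 0" using first by (simp add: algebra_simps power2_eq_square)
  then have e: "\<eta>1 * W = - \<eta> * m * \<phi>1" using assms(1) by simp
  have "2 * \<eta> * (W * (W * \<eta>2 + \<eta> * m * \<phi>2) + \<eta> * (W - 3 * m\<^sup>2) * \<phi>1\<^sup>2)
     = (2 * \<eta>1\<^sup>2 * W + 2 * \<eta> * \<eta>2 * W + 8 * \<eta> * \<eta>1 * m * \<phi>1 + 2 * \<eta>\<^sup>2 * \<phi>1\<^sup>2 + 2 * \<eta>\<^sup>2 * m * \<phi>2) * W"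
    using e by algebra
  also have "\<dots> \<le> 0" using second W0 by (simp add: mult_le_0_iff)
  finally show ?thesis using assms(1) by (simp add: mult_le_0_iff)
qed

text \<open>As \<open>\<psi>\<close> is at most 1 on the cylinder and at least 1/2 at
  \<open>(0, \<tau>)\<close>, comparing \<open>G\<close> there with its maximum reduces the claim to
  \<open>V \<le> 16 N / r\<close> at the maximum point. Otherwise the maximum conditions contradict
  the lower bound on \<open>\<mu>\<close>.\<close>

lemma interior_gradient_estimate:
  fixes f :: "'a::euclidean_space \<times> real \<Rightarrow> real"
  assumes mcf: "mcf_graph U f" and KU: "cball 0 r \<times> {\<delta>..\<tau>} \<subseteq> U"
    and r: "r > 0" and \<delta>: "\<delta> < \<tau>" and N: "4 * r \<le> N"
    and bound: "\<And>z. z \<in> cball 0 r \<times> {\<delta>..\<tau>} \<Longrightarrow> \<bar>f z\<bar> \<le> N / 4"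
    and lam: "\<mu> > 0" "1 / (\<tau> - \<delta>) + 2 * real DIM('a) / r\<^sup>2 < \<mu> / (4 * N\<^sup>2)"
  shows "norm (grad f (0, \<tau>)) * (exp (\<mu> / 2) - 1) \<le> (16 * N / r) * exp \<mu>"
proof -
  interpret mcf_graph U f by (rule mcf)
  \<comment> \<open>The shift by 1/4 outweighs \<open>f / N\<close>, so
    \<open>\<psi> \<le> 0\<close> at time \<open>\<delta>\<close> and where \<open>|x| = r\<close>;
    a positive maximum of \<open>G\<close> avoids both.\<close>
  define \<psi> where "\<psi> = (\<lambda>z. (snd z - \<delta>) / (\<tau> - \<delta>) - (fst z \<bullet> fst z) / r\<^sup>2 + f z / N - 1 / 4)"
  define V where "V = (\<lambda>z. sqrt (1 + (\<Sum>b\<in>Basis. (dx b f z)\<^sup>2)))"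
  define G where "G = (\<lambda>z. (exp (\<mu> * \<psi> z) - 1) * V z)"
  define K where "K = cball (0::'a) r \<times> {\<delta>..\<tau>}"
  have N0: "N > 0" using N r by linarith
  have V_grad: "V z = sqrt (1 + (norm (grad f z))\<^sup>2)" for z by (simp add: V_def norm_grad)
  have V1: "V z \<ge> 1" for z by (simp add: V_grad)
  have K: "compact K" "(0, \<tau>) \<in> K" "K \<subseteq> U"
    unfolding K_def using r \<delta> KU by (auto intro: compact_Times)
  have cf: "continuous_on U f" and cdx: "continuous_on U (dx b f)" for b
    using smooth_on_imp_continuous_on smoothf smooth_on_dd[OF openU smoothf] by auto
  have c\<psi>: "continuous_on U \<psi>"
    unfolding \<psi>_def by (intro continuous_intros cf) (use r N0 \<delta> in auto)
  have cG: "continuous_on U G"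
    unfolding G_def V_def by (intro continuous_intros c\<psi> cdx)
  then obtain z0 where z0: "z0 \<in> K" "\<And>z. z \<in> K \<Longrightarrow> G z \<le> G z0"
    using continuous_attains_sup[OF K(1), of G] K(2,3) continuous_on_subset by blast
  obtain x0 t0 where z0_eq: "z0 = (x0, t0)" by force
  have z0K: "norm x0 \<le> r" "\<delta> \<le> t0" "t0 \<le> \<tau>" using z0 by (auto simp: K_def z0_eq)
  have fN: "\<bar>f z / N\<bar> \<le> 1 / 4" if "z \<in> K" for z
    using bound[of z] that N0 by (simp add: K_def field_simps)
  have \<psi>1: "\<psi> z \<le> 1" if "z \<in> K" for z
  proof -
    have "(snd z - \<delta>) / (\<tau> - \<delta>) \<le> 1" using that \<delta> by (auto simp: K_def)
    moreover have "(fst z \<bullet> fst z) / r\<^sup>2 \<ge> 0" by simp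
    ultimately show ?thesis using fN[OF that] unfolding \<psi>_def by linarith
  qed
  have "\<psi> (0, \<tau>) = 3 / 4 + f (0, \<tau>) / N" using \<delta> by (simp add: \<psi>_def)
  then have "\<psi> (0, \<tau>) \<ge> 1 / 2" using fN[OF K(2)] by linarith
  then have "exp (\<mu> / 2) \<le> exp (\<mu> * \<psi> (0, \<tau>))" using lam by (simp add: field_simps)
  then have low: "(exp (\<mu> / 2) - 1) * V (0, \<tau>) \<le> G (0, \<tau>)"
    unfolding G_def using V1[of "(0, \<tau>)"] by (intro mult_right_mono) auto
  moreover have "0 < (exp (\<mu> / 2) - 1) * V (0, \<tau>)"
    using V1[of "(0, \<tau>)"] lam by (intro mult_pos_pos) auto
  ultimately have Gpos: "G z0 > 0" using z0(2)[OF K(2)] by linarith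
  then have "exp (\<mu> * \<psi> z0) - 1 > 0"
    using V1[of z0] unfolding G_def by (simp add: zero_less_mult_iff)
  then have \<psi>0: "\<psi> z0 > 0" using lam by (simp add: zero_less_mult_iff)
  have nx0: "norm x0 < r"
  proof (rule ccontr)
    assume "\<not> ?thesis"
    then have "x0 \<bullet> x0 = r\<^sup>2" using z0K by (simp add: power2_norm_eq_inner[symmetric])
    moreover have "(t0 - \<delta>) / (\<tau> - \<delta>) \<le> 1" using z0K \<delta> by simp
    moreover have "\<psi> z0 = (t0 - \<delta>) / (\<tau> - \<delta>) - (x0 \<bullet> x0) / r\<^sup>2 + f z0 / N - 1 / 4"
      by (simp add: \<psi>_def z0_eq)
    moreover have "r\<^sup>2 / r\<^sup>2 = 1" using r by simp
    ultimately have "\<psi> z0 \<le> f z0 / N - 1 / 4" by simp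
    then show False using \<psi>0 fN[OF z0(1)] by linarith
  qed
  have t0: "\<delta> < t0"
  proof (rule ccontr)
    assume "\<not> ?thesis"
    then have "t0 - \<delta> = 0" using z0K by simp
    moreover have "(x0 \<bullet> x0) / r\<^sup>2 \<ge> 0" by simp
    moreover have "\<psi> z0 = (t0 - \<delta>) / (\<tau> - \<delta>) - (x0 \<bullet> x0) / r\<^sup>2 + f z0 / N - 1 / 4"
      by (simp add: \<psi>_def z0_eq)
    ultimately have "\<psi> z0 \<le> f z0 / N - 1 / 4" by simp
    then show False using \<psi>0 fN[OF z0(1)] by linarith
  qed
  define W0 where "W0 = U \<inter> (ball 0 r \<times> {\<delta><..})"
  \<comment> \<open>Positivity of \<open>\<psi>\<close> makes the factor
    \<open>exp (\<mu> \<psi>) - 1\<close> positive, so \<open>G\<close> can be compared through its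
    square.\<close>
  define W where "W = {z \<in> W0. \<psi> z \<in> {0<..}}"
  have oW0: "open W0" unfolding W0_def using openU by (intro open_Int open_Times) auto
  have oW: "open W"
    using continuous_open_preimage[OF continuous_on_subset[OF c\<psi>] oW0, of "{0<..}"]
    by (simp add: W_def W0_def vimage_def Int_def)
  have zU: "(x0, t0) \<in> U" using z0 K z0_eq by auto
  have zW: "(x0, t0) \<in> W" using zU nx0 t0 \<psi>0 by (simp add: W_def W0_def z0_eq)
  have WU: "z \<in> U" if "z \<in> W" for z using that by (simp add: W_def W0_def)
  have WK: "z \<in> K" if "z \<in> W" "snd z \<le> t0" for z
    using that z0K by (cases z) (auto simp: W_def W0_def K_def)
  have V0: "V z0 \<le> 16 * N / r"
  proof (rule ccontr)
    assume "\<not> V z0 \<le> 16 * N / r"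
    then have Vbig: "V z0 > 16 * N / r" by simp
    define p where "p = grad f (x0, t0)"
    define m where "m = norm p"
    define D where "D = 1 + m\<^sup>2"
    have D: "D = (V z0)\<^sup>2" "D > 0" by (simp_all add: V_grad D_def m_def p_def z0_eq add_pos_nonneg)
    \<comment> \<open>\<open>4 r \<le> N\<close> turns the supposed steepness into an absolute
      bound, which makes \<open>m\<close> nonzero and \<open>m^2 / D\<close> close to 1.\<close>
    have "64 \<le> 16 * N / r" using N r by (simp add: field_simps)
    then have Vgt: "V z0 > 64" using Vbig by linarith
    then have "64\<^sup>2 < (V z0)\<^sup>2" by (intro power_strict_mono) auto
    then have D2: "D > 4096" using D by simp
    have m0: "m > 0"
    proof (rule ccontr)
      assume "\<not> m > 0"
      then have "m = 0" using norm_ge_zero[of p] by (simp add: m_def)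
      then show False using D2 by (simp add: D_def)
    qed
    define e where "e = (1 / m) *\<^sub>R p"
    have e: "norm e = 1" "grad f (x0, t0) = m *\<^sub>R e" using m0 by (simp_all add: e_def m_def p_def)
    define \<phi> where "\<phi> = dx e f"
    interpret phi: smooth_spacetime U \<phi> unfolding \<phi>_def by (rule smooth_dd)
    have phi0: "\<phi> (x0, t0) = m"
      unfolding \<phi>_def dx_inner_grad[OF zU] e(2) using e(1) by (simp add: power2_norm_eq_inner[symmetric])
    define \<eta> where "\<eta> = (\<lambda>z. exp (\<mu> * \<psi> z) - 1)"
    \<comment> \<open>Squaring removes the root in \<open>V\<close>. With \<open>\<phi>\<close> in
      place of \<open>|du|\<close>, \<open>H\<close> is at most \<open>G^2\<close> and equals it at
      \<open>z0\<close>, so the maximum is kept.\<close>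
    define H where "H = (\<lambda>z. (\<eta> z)\<^sup>2 * (1 + (\<phi> z)\<^sup>2))"
    have max: "H z \<le> H (x0, t0)" if z: "z \<in> W" "snd z \<le> t0" for z
    proof -
      have eta: "\<eta> z > 0" using z lam by (simp add: \<eta>_def W_def)
      have "\<bar>\<phi> z\<bar> \<le> norm (grad f z)"
        unfolding \<phi>_def dx_inner_grad[OF WU[OF z(1)]] using Cauchy_Schwarz_ineq2[of e "grad f z"] e by simp
      then have "(\<phi> z)\<^sup>2 \<le> (norm (grad f z))\<^sup>2" by (metis abs_ge_zero power2_abs power_mono)
      then have "H z \<le> (\<eta> z)\<^sup>2 * (1 + (norm (grad f z))\<^sup>2)"
        unfolding H_def by (intro mult_left_mono) auto
      also have "\<dots> = (G z)\<^sup>2"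
        by (simp add: G_def \<eta>_def V_grad power_mult_distrib)
      also have "\<dots> \<le> (G z0)\<^sup>2"
        using z0(2)[OF WK[OF z]] eta V1[of z] by (intro power_mono) (auto simp: G_def \<eta>_def)
      also have "\<dots> = H (x0, t0)"
        by (simp add: G_def H_def \<eta>_def V_grad power_mult_distrib phi0 m_def p_def z0_eq)
      finally show ?thesis .
    qed
    define E where "E = exp (\<mu> * \<psi> z0)"
    define h where "h = \<eta> (x0, t0)"
    have h0: "h > 0" using \<psi>0 lam by (simp add: h_def \<eta>_def z0_eq)
    define \<psi>1 where "\<psi>1 = (\<lambda>w z. - 2 * (fst z \<bullet> w) / r\<^sup>2 + dx w f z / N)"
    define \<psi>2 where "\<psi>2 = (\<lambda>w. - 2 * (w \<bullet> w) / r\<^sup>2 + dx w (dx w f) (x0, t0) / N)"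
    define \<eta>2 where "\<eta>2 = (\<lambda>w. \<mu> * E * (\<psi>2 w + \<mu> * (\<psi>1 w (x0, t0))\<^sup>2))"
    have dpsi: "((\<lambda>s. \<psi> (x0 + s *\<^sub>R w, t0)) has_real_derivative \<psi>1 w (x0 + s *\<^sub>R w, t0)) (at s)"
      if "(x0 + s *\<^sub>R w, t0) \<in> U" for s w
    proof -
      have "((\<lambda>s. (x0 + s *\<^sub>R w) \<bullet> (x0 + s *\<^sub>R w)) has_real_derivative 2 * ((x0 + s *\<^sub>R w) \<bullet> w)) (at s)"
        by (auto intro!: derivative_eq_intros simp: inner_commute algebra_simps)
      from DERIV_add[OF DERIV_diff[OF DERIV_const DERIV_cdivide[OF this, of "r\<^sup>2"]] DERIV_cdivide[OF line[OF that], of N]]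
      have "((\<lambda>s. (t0 - \<delta>) / (\<tau> - \<delta>) - (x0 + s *\<^sub>R w) \<bullet> (x0 + s *\<^sub>R w) / r\<^sup>2 + f (x0 + s *\<^sub>R w, t0) / N)
         has_real_derivative \<psi>1 w (x0 + s *\<^sub>R w, t0)) (at s)"
        by (simp add: \<psi>1_def)
      from DERIV_diff[OF this DERIV_const[of "1 / 4"]] show ?thesis by (simp add: \<psi>_def)
    qed
    have deta: "((\<lambda>s. \<eta> (x0 + s *\<^sub>R w, t0)) has_real_derivative
        \<mu> * exp (\<mu> * \<psi> (x0 + s *\<^sub>R w, t0)) * \<psi>1 w (x0 + s *\<^sub>R w, t0)) (at s)"
      if "(x0 + s *\<^sub>R w, t0) \<in> U" for s w
      unfolding \<eta>_def using that by (auto intro!: derivative_eq_intros dpsi)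
    have sp: "D * (D * \<eta>2 w + h * m * dx w (dx w \<phi>) (x0, t0)) + h * (D - 3 * m\<^sup>2) * (dx w \<phi> (x0, t0))\<^sup>2 \<le> 0" for w
    proof -
      interpret fw: smooth_spacetime U "dx w f" by (rule smooth_dd)
      interpret pw: smooth_spacetime U "dx w \<phi>" by (rule phi.smooth_dd)
      define \<eta>1 where "\<eta>1 = (\<lambda>s. \<mu> * exp (\<mu> * \<psi> (x0 + s *\<^sub>R w, t0)) * \<psi>1 w (x0 + s *\<^sub>R w, t0))"
      have at0: "(x0 + 0 *\<^sub>R w, t0) \<in> U" using zU by simp
      have "((\<lambda>s. \<psi>1 w (x0 + s *\<^sub>R w, t0)) has_real_derivative \<psi>2 w) (at 0)"
      proof -
        have "((\<lambda>s. - 2 * ((x0 + s *\<^sub>R w) \<bullet> w)) has_real_derivative - 2 * (w \<bullet> w)) (at 0)"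
          unfolding inner_add_left inner_scaleR_left by (auto intro!: derivative_eq_intros)
        from DERIV_add[OF DERIV_cdivide[OF this, of "r\<^sup>2"] DERIV_cdivide[OF fw.line[OF at0], of N]]
        show ?thesis by (simp add: \<psi>1_def \<psi>2_def)
      qed
      then have d\<eta>1: "(\<eta>1 has_real_derivative \<eta>2 w) (at 0)"
        unfolding \<eta>1_def \<eta>2_def using dpsi[OF at0]
        by (auto intro!: derivative_eq_intros simp: E_def z0_eq algebra_simps power2_eq_square)
      define h1 where "h1 = (\<lambda>s. 2 * \<eta> (x0 + s *\<^sub>R w, t0) * \<eta>1 s * (1 + (\<phi> (x0 + s *\<^sub>R w, t0))\<^sup>2)
          + 2 * (\<eta> (x0 + s *\<^sub>R w, t0))\<^sup>2 * \<phi> (x0 + s *\<^sub>R w, t0) * dx w \<phi> (x0 + s *\<^sub>R w, t0))"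
      have dH: "((\<lambda>s. H (x0 + s *\<^sub>R w, t0)) has_real_derivative h1 s) (at s)" if s: "(x0 + s *\<^sub>R w, t0) \<in> W" for s
        unfolding H_def h1_def \<eta>1_def
        by (rule derivative_eq_intros deta phi.line WU[OF s] refl | simp add: algebra_simps power2_eq_square)+
      let ?D = "2 * (\<eta>1 0)\<^sup>2 * D + 2 * h * \<eta>2 w * D + 8 * h * \<eta>1 0 * m * dx w \<phi> (x0, t0)
          + 2 * h\<^sup>2 * (dx w \<phi> (x0, t0))\<^sup>2 + 2 * h\<^sup>2 * m * dx w (dx w \<phi>) (x0, t0)"
      have de: "((\<lambda>s. \<eta> (x0 + s *\<^sub>R w, t0)) has_real_derivative \<eta>1 0) (at 0)"
        unfolding \<eta>1_def by (rule deta[OF at0])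
      have dh1: "(h1 has_real_derivative ?D) (at 0)"
        unfolding h1_def using phi0
        by (auto intro!: derivative_eq_intros de d\<eta>1 phi.line[OF at0] pw.line[OF at0]
              simp: h_def D_def power2_eq_square algebra_simps)
      have "h1 0 = 0" "?D \<le> 0"
        using spatial_max[OF oW zW max dH dh1] by auto
      then show ?thesis
        by (intro product_max_combine[OF h0 D_def, of "\<eta>1 0"]) (auto simp: h1_def h_def phi0 D_def)
    qed
    define S1 where "S1 = (\<Sum>b\<in>Basis. (dx (frame p b) \<phi> (x0, t0))\<^sup>2)"
    define S2 where "S2 = (\<Sum>b\<in>Basis. dx (frame p b) (dx (frame p b) \<phi>) (x0, t0))"
    define R2 where "R2 = (\<Sum>b\<in>Basis. \<eta>2 (frame p b))"
    have "(\<Sum>b\<in>Basis. D * (D * \<eta>2 (frame p b) + h * m * dx (frame p b) (dx (frame p b) \<phi>) (x0, t0))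
         + h * (D - 3 * m\<^sup>2) * (dx (frame p b) \<phi> (x0, t0))\<^sup>2) \<le> 0"
      by (intro sum_nonpos sp)
    then have spsum: "D * (D * R2 + h * m * S2) + h * (D - 3 * m\<^sup>2) * S1 \<le> 0"
      unfolding sum.distrib sum_distrib_left[symmetric] S1_def S2_def R2_def .
    have phit: "dt \<phi> (x0, t0) = S2 - 2 * m / D * S1"
      using directional_derivative_flow[OF zU e(2,1)] by (simp add: S1_def S2_def D_def \<phi>_def p_def)
    define \<eta>t where "\<eta>t = \<mu> * E * (1 / (\<tau> - \<delta>) + dt f (x0, t0) / N)"
    have "((\<lambda>s. (s - \<delta>)) has_real_derivative 1) (at t0)"
      by (auto intro!: derivative_eq_intros)
    from DERIV_diff[OF DERIV_add[OF DERIV_diff[OF DERIV_cdivide[OF this, of "\<tau> - \<delta>"] DERIV_const] DERIV_cdivide[OF time_line[OF zU], of N]] DERIV_const]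
    have "((\<lambda>s. \<psi> (x0, s)) has_real_derivative 1 / (\<tau> - \<delta>) + dt f (x0, t0) / N) (at t0)"
      by (simp add: \<psi>_def)
    then have "((\<lambda>s. \<eta> (x0, s)) has_real_derivative \<eta>t) (at t0)"
      unfolding \<eta>_def \<eta>t_def
      by (auto intro!: derivative_eq_intros simp: E_def z0_eq)
    then have "((\<lambda>s. H (x0, s)) has_real_derivative 2 * h * \<eta>t * D + 2 * h\<^sup>2 * m * dt \<phi> (x0, t0)) (at t0)"
      unfolding H_def
      by (auto intro!: derivative_eq_intros phi.time_line zU simp: h_def D_def phi0 power2_eq_square)
    from temporal_max[OF oW zW max this] have "0 \<le> 2 * h * (\<eta>t * D + h * m * dt \<phi> (x0, t0))"
      by (simp add: algebra_simps power2_eq_square)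
    then have "0 \<le> \<eta>t * D + h * m * dt \<phi> (x0, t0)" using h0 by (simp add: zero_le_mult_iff)
    then have "0 \<le> D * (\<eta>t * D + h * m * dt \<phi> (x0, t0))" using D by simp
    also have "\<dots> = D * (\<eta>t * D + h * m * S2) - 2 * h * m\<^sup>2 * S1"
      unfolding phit using D(2) by (simp add: field_simps power2_eq_square)
    finally have "0 \<le> D * (\<eta>t * D + h * m * S2) - 2 * h * m\<^sup>2 * S1" .
    \<comment> \<open>Subtraction cancels \<open>S2\<close> and leaves \<open>S1\<close> with
      coefficient \<open>- h (D - 3 m^2) - 2 h m^2 = - h (D - m^2)\<close>, where
      \<open>D - m^2 = 1\<close>; this sign allows \<open>S1\<close> to be dropped.\<close>
    with spsum have "0 \<le> D\<^sup>2 * (\<eta>t - R2) - h * (D - m\<^sup>2) * S1"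
      by (simp add: algebra_simps power2_eq_square)
    moreover have "h * (D - m\<^sup>2) * S1 \<ge> 0"
      using h0 by (simp add: D_def S1_def sum_nonneg)
    ultimately have "0 \<le> D\<^sup>2 * (\<eta>t - R2)" by linarith
    then have etaR: "R2 \<le> \<eta>t" using D by (simp add: zero_le_mult_iff)
    define P where "P = (\<Sum>b\<in>Basis. (\<psi>1 (frame p b) (x0, t0))\<^sup>2)"
    have "R2 = \<mu> * E * (- 2 / r\<^sup>2 * (\<Sum>b\<in>Basis. frame p b \<bullet> frame p b) + dt f (x0, t0) / N + \<mu> * P)"
      unfolding flow_frame[OF zU] p_def[symmetric] R2_def \<eta>2_def \<psi>2_def P_def
      by (simp add: sum_distrib_left sum.distrib sum_divide_distrib sum_negf sum_subtractf algebra_simps)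
    \<comment> \<open>By the flow equation \<open>dt f / N\<close> occurs on both sides and cancels,
      leaving \<open>\<mu> * P\<close> against the cutoff terms.\<close>
    with etaR have "\<mu> * E * (\<mu> * P) \<le> \<mu> * E * (1 / (\<tau> - \<delta>) + 2 / r\<^sup>2 * (\<Sum>b\<in>Basis. frame p b \<bullet> frame p b))"
      by (simp add: \<eta>t_def algebra_simps)
    moreover have "\<mu> * E > 0" using lam by (simp add: E_def)
    ultimately have "\<mu> * P \<le> 1 / (\<tau> - \<delta>) + 2 / r\<^sup>2 * (\<Sum>b\<in>Basis. frame p b \<bullet> frame p b)"
      by (simp only: mult_le_cancel_left_pos)
    also have "\<dots> \<le> 1 / (\<tau> - \<delta>) + 2 / r\<^sup>2 * real DIM('a)"
      unfolding sum_frame_norm using r by (intro add_left_mono mult_left_mono) auto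
    also have "\<dots> < \<mu> / (4 * N\<^sup>2)" using lam(2) by simp
    finally have "\<mu> * P < \<mu> * (1 / (4 * N\<^sup>2))" by simp
    then have Pup: "P < 1 / (4 * N\<^sup>2)" using lam(1) by (simp only: mult_less_cancel_left_pos)
    \<comment> \<open>The square of the cutoff part is discarded; the other two sums are
      contractions with \<open>p\<close>, evaluated by \<open>sum_frame_inner_self\<close>.\<close>
    have "P \<ge> (\<Sum>b\<in>Basis. 1 / N\<^sup>2 * ((frame p b \<bullet> p) * (frame p b \<bullet> p)) - 4 / (N * r\<^sup>2) * ((frame p b \<bullet> p) * (frame p b \<bullet> x0)))"
      unfolding P_def
    proof (rule sum_mono)
      fix b :: 'a
      define \<alpha> where "\<alpha> = (frame p b \<bullet> p) / N"
      define \<beta> where "\<beta> = 2 * (frame p b \<bullet> x0) / r\<^sup>2"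
      have "(\<psi>1 (frame p b) (x0, t0))\<^sup>2 = (\<alpha> - \<beta>)\<^sup>2"
        by (simp add: \<psi>1_def dx_inner_grad[OF zU] p_def \<alpha>_def \<beta>_def inner_commute algebra_simps)
      also have "\<dots> \<ge> \<alpha> * \<alpha> - 2 * \<alpha> * \<beta>" by (simp add: power2_eq_square algebra_simps)
      also have "\<alpha> * \<alpha> - 2 * \<alpha> * \<beta> = 1 / N\<^sup>2 * ((frame p b \<bullet> p) * (frame p b \<bullet> p)) - 4 / (N * r\<^sup>2) * ((frame p b \<bullet> p) * (frame p b \<bullet> x0))"
        by (simp add: \<alpha>_def \<beta>_def power2_eq_square)
      finally show "1 / N\<^sup>2 * ((frame p b \<bullet> p) * (frame p b \<bullet> p)) - 4 / (N * r\<^sup>2) * ((frame p b \<bullet> p) * (frame p b \<bullet> x0))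
        \<le> (\<psi>1 (frame p b) (x0, t0))\<^sup>2" .
    qed
    also have "(\<Sum>b\<in>Basis. 1 / N\<^sup>2 * ((frame p b \<bullet> p) * (frame p b \<bullet> p)) - 4 / (N * r\<^sup>2) * ((frame p b \<bullet> p) * (frame p b \<bullet> x0)))
       = 1 / N\<^sup>2 * (m\<^sup>2 / D) - 4 / (N * r\<^sup>2) * ((p \<bullet> x0) / D)"
      unfolding sum_subtractf sum_distrib_left[symmetric] sum_frame_inner_self
      by (simp add: D_def m_def power2_norm_eq_inner)
    finally have Plow: "1 / N\<^sup>2 * (m\<^sup>2 / D) - 4 / (N * r\<^sup>2) * ((p \<bullet> x0) / D) \<le> P" .
    have A: "1 / N\<^sup>2 * (1 / 2) \<le> 1 / N\<^sup>2 * (m\<^sup>2 / D)"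
      using D2 by (intro mult_left_mono) (auto simp: D_def field_simps)
    \<comment> \<open>The threshold \<open>16 N / r\<close> is chosen so that this mixed term is at
      most half of the lower bound \<open>1 / (2 N^2)\<close> for the main term.\<close>
    have B: "4 / (N * r\<^sup>2) * ((p \<bullet> x0) / D) \<le> 1 / (4 * N\<^sup>2)"
    proof -
      have "m\<^sup>2 \<le> (V z0)\<^sup>2" using D(1) unfolding D_def by linarith
      then have "m \<le> V z0" by (rule power2_le_imp_le) (use V1[of z0] in auto)
      have "p \<bullet> x0 \<le> m * r"
        using norm_cauchy_schwarz[of p x0] mult_left_mono[of "norm x0" r m] nx0 m0 unfolding m_def by linarith
      also have "\<dots> \<le> V z0 * r" using \<open>m \<le> V z0\<close> r by simp
      finally have "(p \<bullet> x0) / D \<le> (V z0 * r) / D" using D by (intro divide_right_mono) auto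
      also have "\<dots> = r / V z0" using Vgt by (simp add: D power2_eq_square)
      also have "\<dots> \<le> r / (16 * N / r)" using Vbig Vgt r N0 by (intro divide_left_mono) auto
      finally have "4 / (N * r\<^sup>2) * ((p \<bullet> x0) / D) \<le> 4 / (N * r\<^sup>2) * (r / (16 * N / r))"
        using N0 r by (intro mult_left_mono) auto
      also have "\<dots> = 1 / (4 * N\<^sup>2)" using N0 r by (simp add: field_simps power2_eq_square)
      finally show ?thesis .
    qed
    have "1 / N\<^sup>2 * (1 / 2) = 1 / (4 * N\<^sup>2) + 1 / (4 * N\<^sup>2)" using N0 by (simp add: field_simps)
    with A have "1 / (4 * N\<^sup>2) + 1 / (4 * N\<^sup>2) \<le> 1 / N\<^sup>2 * (m\<^sup>2 / D)" by (simp only:)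
    from diff_mono[OF this B] Plow Pup show False by simp
  qed
  have "norm (grad f (0, \<tau>)) \<le> V (0, \<tau>)" unfolding V_grad by (intro real_le_rsqrt) auto
  then have "norm (grad f (0, \<tau>)) * (exp (\<mu> / 2) - 1) \<le> (exp (\<mu> / 2) - 1) * V (0, \<tau>)"
    using lam by (subst mult.commute) (intro mult_left_mono, auto)
  also have "\<dots> \<le> G z0" using low z0(2)[OF K(2)] by linarith
  also have "\<dots> \<le> exp \<mu> * (16 * N / r)"
    unfolding G_def
  proof (rule mult_mono[OF _ V0])
    have "\<mu> * \<psi> z0 \<le> \<mu>" using \<psi>1[OF z0(1)] lam by simp
    then show "exp (\<mu> * \<psi> z0) - 1 \<le> exp \<mu>" by (smt (verit) exp_le_cancel_iff)
  qed (use V1[of z0] in auto)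
  finally show ?thesis by (simp add: mult.commute)
qed

section \<open>The logarithmic gradient estimate\<close>

lemma log_gradient_estimate:
  fixes u :: "'a::euclidean_space \<Rightarrow> real \<Rightarrow> real"
  assumes r: "r > 0"
    and flows: "graph_flows_by_mean_curvature (sqrt (2 * real DIM('a) + 1) * r) (r\<^sup>2) u"
    and M: "\<And>x. x \<in> ball 0 (sqrt (2 * real DIM('a) + 1) * r) \<Longrightarrow> \<bar>u x 0\<bar> \<le> M"
    and g: "gradient (\<lambda>x. u x (r\<^sup>2 / (4 * real DIM('a)))) 0 \<noteq> 0"
  shows "ln (norm (gradient (\<lambda>x. u x (r\<^sup>2 / (4 * real DIM('a)))) 0)) \<le> (128 + 2561 * real DIM('a)) * (1 + M / r)\<^sup>2"
proof -
  define n where "n = real DIM('a)"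
  define R where "R = sqrt (2 * n + 1) * r"
  define f where "f = (\<lambda>(x, t). u x t)"
  define \<tau> where "\<tau> = r\<^sup>2 / (4 * n)"
  define y where "y = 1 + M / r"
  \<comment> \<open>With \<open>N = 8 r y\<close> and time span \<open>\<tau> / 2\<close>, the
    condition on \<open>\<mu>\<close> becomes \<open>10 n < \<mu> / (256 y^2)\<close>, and 2561 just
    exceeds 2560.\<close>
  define \<mu> where "\<mu> = 2561 * n * y\<^sup>2"
  \<comment> \<open>\<open>\<rho>^2 = 2 r^2\<close> exceeds
    \<open>r^2 + 2 n \<tau> = 3 r^2 / 2\<close>, as the height bound needs, and
    \<open>\<rho>\<close> is below \<open>sqrt (2 n + 1) r\<close>.\<close>
  define \<rho> where "\<rho> = sqrt 2 * r"
  have n1: "n \<ge> 1" using DIM_positive[where 'a='a] by (simp add: n_def Suc_leI)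
  have R0: "R > 0" using r n1 by (simp add: R_def)
  have M0: "M \<ge> 0" using M[of 0] R0 by (simp add: R_def n_def)
  have y1: "y \<ge> 1" using M0 r by (simp add: y_def)
  have y2: "y \<le> y\<^sup>2" using y1 by (simp add: power2_eq_square)
  have \<tau>: "0 < \<tau>" "\<tau> < r\<^sup>2" using r n1 by (simp_all add: \<tau>_def field_simps)
  have mcf: "mcf_graph (ball 0 R \<times> {0<..<r\<^sup>2}) f"
    unfolding f_def R_def n_def by (rule graph_flow_imp_mcf_graph[OF flows])
  interpret mcf_graph "ball 0 R \<times> {0<..<r\<^sup>2}" f by (rule mcf)
  have "continuous_on (ball 0 R \<times> {0..r\<^sup>2}) f"
    using flows smooth_on_imp_continuous_on
    unfolding graph_flows_by_mean_curvature_def f_def R_def n_def by blast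
  then have cont: "continuous_on (ball 0 R \<times> {0..<r\<^sup>2}) f"
    by (rule continuous_on_subset) auto
  have \<rho>: "0 < \<rho>" "\<rho> < R" "\<rho> \<le> 2 * r"
  proof -
    show "0 < \<rho>" using r by (simp add: \<rho>_def)
    show "\<rho> < R" unfolding \<rho>_def R_def using r n1 by simp
    have "sqrt 2 \<le> 2" by (rule real_le_lsqrt) auto
    then show "\<rho> \<le> 2 * r" using r by (simp add: \<rho>_def)
  qed
  have rR: "r < R"
  proof -
    have "1 * r < sqrt (2 * n + 1) * r" using r n1 by (intro mult_strict_right_mono) auto
    then show ?thesis by (simp add: R_def)
  qed
  have init: "\<bar>f (x, 0)\<bar> \<le> M" if "norm x \<le> \<rho>" for x
    using M[of x] that \<rho> by (simp add: f_def R_def n_def)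
  \<comment> \<open>Starting at \<open>\<tau> / 2\<close> keeps the cylinder inside the open time
    interval of the flow; \<open>8 r y = 8 (r + M)\<close> is the value of \<open>N\<close>.\<close>
  have bound: "\<bar>f z\<bar> \<le> (8 * r * y) / 4" if z: "z \<in> cball 0 r \<times> {\<tau>/2..\<tau>}" for z
  proof -
    obtain x t where xt: "z = (x, t)" "norm x \<le> r" "\<tau> / 2 \<le> t" "t \<le> \<tau>" using z by (cases z) auto
    have "(norm x)\<^sup>2 \<le> r\<^sup>2" using xt by (intro power_mono) auto
    moreover have "2 * n * t \<le> 2 * n * \<tau>" using xt n1 by (intro mult_left_mono) auto
    moreover have "2 * n * \<tau> = r\<^sup>2 / 2" using n1 by (simp add: \<tau>_def)
    moreover have "\<rho>\<^sup>2 = 2 * r\<^sup>2" by (simp add: \<rho>_def power_mult_distrib)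
    moreover have "r\<^sup>2 > 0" using r by simp
    ultimately have "(norm x)\<^sup>2 + 2 * real DIM('a) * t < \<rho>\<^sup>2" unfolding n_def by linarith
    from height_bound[OF mcf cont \<rho>(1,2) init _ _ this] have "\<bar>f (x, t)\<bar> \<le> M + \<rho>"
      using xt \<tau> by linarith
    also have "\<dots> \<le> 2 * r + 2 * M" using \<rho>(3) M0 by linarith
    also have "\<dots> = 2 * r * y" using r by (simp add: y_def field_simps)
    finally show ?thesis by (simp add: xt)
  qed
  have lam: "\<mu> > 0" using n1 y1 by (simp add: \<mu>_def)
  have KU: "cball 0 r \<times> {\<tau>/2..\<tau>} \<subseteq> ball 0 R \<times> {0<..<r\<^sup>2}" using rR \<tau> by auto
  have "1 / (\<tau> - \<tau> / 2) + 2 * n / r\<^sup>2 = 10 * n / r\<^sup>2"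
    using n1 r by (simp add: \<tau>_def field_simps)
  also have "\<dots> < 2561 / 256 * n / r\<^sup>2" using n1 r by (intro divide_strict_right_mono) auto
  also have "\<dots> = \<mu> / (4 * (8 * r * y)\<^sup>2)"
    using y1 r by (simp add: \<mu>_def power_mult_distrib)
  finally have lam2: "1 / (\<tau> - \<tau> / 2) + 2 * real DIM('a) / r\<^sup>2 < \<mu> / (4 * (8 * r * y)\<^sup>2)" by (simp add: n_def)
  define v where "v = norm (grad f (0, \<tau>))"
  have gr: "gradient (\<lambda>x. u x \<tau>) 0 = grad f (0, \<tau>)"
    using gradient_slice[of 0 \<tau>] R0 \<tau> by (simp add: f_def)
  have v0: "v > 0" using g gr by (simp add: v_def \<tau>_def n_def)
  have "v * (exp (\<mu> / 2) - 1) \<le> (16 * (8 * r * y) / r) * exp \<mu>"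
    unfolding v_def
    by (rule interior_gradient_estimate[OF mcf KU r _ _ bound lam lam2]) (use \<tau> y1 r in auto)
  also have "\<dots> = 128 * y * exp \<mu>" using r by simp
  finally have "v * (exp (\<mu> / 2) - 1) \<le> 128 * y * exp \<mu>" .
  \<comment> \<open>\<open>\<mu> \<ge> 2\<close> makes the factor at least 1.\<close>
  moreover have "v \<le> v * (exp (\<mu> / 2) - 1)"
  proof -
    have "1 * 1 \<le> n * y\<^sup>2" using n1 y1 by (intro mult_mono) auto
    then have "\<mu> \<ge> 2" by (simp add: \<mu>_def)
    then have "exp (\<mu> / 2) - 1 \<ge> 1" using exp_ge_add_one_self[of "\<mu> / 2"] by linarith
    then show ?thesis using v0 by simp
  qed
  ultimately have "v \<le> 128 * y * exp \<mu>" by linarith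
  then have "ln v \<le> ln (128 * y * exp \<mu>)" using v0 y1 by (subst ln_le_cancel_iff) auto
  also have "\<dots> = ln (128 * y) + \<mu>" using y1 by (simp add: ln_mult)
  also have "\<dots> \<le> 128 * y + \<mu>" using ln_bound[of "128 * y"] y1 by simp
  also have "\<dots> \<le> (128 + 2561 * n) * y\<^sup>2" using y2 by (simp add: \<mu>_def algebra_simps)
  finally show ?thesis using gr by (simp add: v_def y_def n_def \<tau>_def)
qed

theorem theorem1:
  shows "\<exists>C::real. \<forall>(r::real) (u :: real ^ 'n \<Rightarrow> real \<Rightarrow> real).
    r > 0 \<longrightarrow>
    graph_flows_by_mean_curvature (sqrt (2 * real CARD('n) + 1) * r) (r\<^sup>2) u \<longrightarrow>
    ext_log (norm (gradient (\<lambda>x. u x (r\<^sup>2 / (4 * real CARD('n)))) 0))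
      \<le> ereal C *
        (1 + ereal (inverse r) *
             sup_norm_on (ball 0 (sqrt (2 * real CARD('n) + 1) * r)) (\<lambda>x. u x 0))\<^sup>2"
proof (intro exI allI impI)
  fix r :: real and u :: "real ^ 'n \<Rightarrow> real \<Rightarrow> real"
  let ?B = "ball (0 :: real ^ 'n) (sqrt (2 * real CARD('n) + 1) * r)"
  let ?S = "sup_norm_on ?B (\<lambda>x. u x 0)" and ?g = "gradient (\<lambda>x. u x (r\<^sup>2 / (4 * real CARD('n)))) 0"
  define C where "C = 128 + 2561 * real CARD('n)"
  assume r: "r > 0" and flows: "graph_flows_by_mean_curvature (sqrt (2 * real CARD('n) + 1) * r) (r\<^sup>2) u"
  have C: "C > 0" unfolding C_def by (rule add_pos_nonneg) simp_all
  have le: "ereal \<bar>u x 0\<bar> \<le> ?S" if "x \<in> ?B" for x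
    unfolding sup_norm_on_def using that by (rule SUP_upper)
  have "0 \<in> ?B" using r by simp
  from order_trans[OF _ le[OF this], of 0] have S0: "?S \<ge> 0" by simp
  have "ext_log (norm ?g) \<le> ereal C * (1 + ereal (inverse r) * ?S)\<^sup>2"
  proof (cases "?g = 0")
    case True
    \<comment> \<open>The left side is \<open>-\<infinity>\<close> here.\<close>
    then show ?thesis by (simp add: ext_log_def)
  next
    case g: False
    show ?thesis
    proof (cases ?S)
      case (real M)
      have "\<bar>u x 0\<bar> \<le> M" if "x \<in> ?B" for x using le[OF that] real by simp
      then have a: "ln (norm ?g) \<le> C * (1 + M / r)\<^sup>2"
        using log_gradient_estimate[of r u M] r flows g by (simp add: C_def)
      have b: "1 + ereal (inverse r) * ereal M = ereal (1 + M / r)"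
        by (simp add: divide_inverse mult.commute one_ereal_def)
      show ?thesis
        using g a unfolding real b ext_log_def by (simp add: power2_eq_square)
    next
      case PInf
      \<comment> \<open>For unbounded initial data the right side is infinite because
        \<open>C > 0\<close>.\<close>
      then have inf: "1 + ereal (inverse r) * ?S = \<infinity>" using r by simp
      show ?thesis unfolding inf using C by (simp add: power2_eq_square)
    next
      case MInf
      then show ?thesis using S0 by simp
    qed
  qed
  then show "ext_log (norm ?g) \<le> ereal (128 + 2561 * real CARD('n)) * (1 + ereal (inverse r) * ?S)\<^sup>2"
    by (simp add: C_def)
qed

end
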